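(* Let $d\ge1$, $r\ge1$, and let $k$ be a field containing a primitive $d$-th root of unity. The sequence of diagonal coinvariant algebras $\mathcal{C}^{(r)}(n)$, $n\ge0$, of the groups $W_n=\mathbb{Z}/d\mathbb{Z}\wr S_n$ over $k$ forms a graded co-$\mathrm{FI}_{\mathbb{Z}/d\mathbb{Z}}$-algebra of finite type.
   Context: Let $G=\mathbb{Z}/d\mathbb{Z}$ and $\zeta_d\in k$ a primitive $d$-th root of unity. $W_n=G\wr S_n$ acts on $V_n=k^n$ by permutation matrices whose nonzero entries are powers of $\zeta_d$. $k[V_n^{\oplus r}]=k[x_j^{(s)}:1\le s\le r,\ 1\le j\le n]$ carries the diagonal $W_n$-action and a grading by $r$-tuples $J=(j_1,\dots,j_r)$, where $j_s$ is the total degree in $x_1^{(s)},\dots,x_n^{(s)}$. Let $\mathcal{I}_n\subset k[V_n^{\oplus r}]$ be the ideal generated by the $W_n$-invariant polynomials with zero constant term, and $\mathcal{C}^{(r)}(n)=k[V_n^{\oplus r}]/\mathcal{I}_n$, with graded pieces $\mathcal{C}^{(r)}_J(n)$. For a group $G$, $\mathrm{FI}_G$ is the category whose objects are finite sets and whose morphisms $R\to S$ are pairs $(a,(g_i)_{i\in R})$ with $a:R\to S$ injective and $g_i\in G$; composition is $(b,(h_j))\circ(a,(g_i))=(b\circ a,(g_ih_{a(i)}))$. A co-$\mathrm{FI}_G$-module (resp. graded co-$\mathrm{FI}_G$-algebra) is a functor from $\mathrm{FI}_G^{\mathrm{op}}$ to $k$-modules (resp. graded $k$-algebras). It is of finite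 type if each graded piece is finite-dimensional for each $n$ and each graded piece is finitely generated, in the sense that its dual is a finitely generated $\mathrm{FI}_G$-module (finitely many elements lie in no proper $\mathrm{FI}_G$-submodule). The co-$\mathrm{FI}_G$-structure is induced from the maps $V_m^{\oplus r}\to V_n^{\oplus r}$: a morphism $(a,(g_j)):[m]\to[n]$ sends $x^{(s)}_{a(j)}\mapsto\zeta_d^{g_j}x^{(s)}_j$ and $x^{(s)}_l\mapsto0$ for $l$ not in the image of $a$. In particular the standard inclusion $[n]\hookrightarrow[n+1]$ sends $x_l^{(s)}\mapsto x_l^{(s)}$ for $l\le n$ and $x_{n+1}^{(s)}\mapsto0$. *)

theory Defs
  imports
    "HOL-Library.Poly_Mapping"
    "HOL-Algebra.QuotRing"
    "HOL-Algebra.Bij"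
    "HOL-Algebra.Elementary_Groups"
    "HOL-Algebra.Algebraic_Closure_Type"
    "Jordan_Normal_Form.Missing_VectorSpace"
begin

section \<open>The category of finite sets and G-decorated injections\<close>

text \<open>
  The objects are the finite subsets of \<^typ>\<open>nat\<close>; this full subcategory is equivalent to the
  category of all finite sets and contains the sets \<open>{1..n}\<close>.  A morphism from \<open>R\<close> to \<open>S\<close> is a
  pair \<open>(a, g)\<close>; both components are undefined outside \<open>R\<close>, so that equality of morphisms is
  equality of pairs.
\<close>

type_synonym 'g FI_mor = "(nat \<Rightarrow> nat) \<times> (nat \<Rightarrow> 'g)"

definition FI_hom :: "('g, 'm) monoid_scheme \<Rightarrow> nat set \<Rightarrow> nat set \<Rightarrow> 'g FI_mor set" where
  "FI_hom G R S = {(a, g). a \<in> R \<rightarrow>\<^sub>E S \<and> inj_on a R \<and> g \<in> R \<rightarrow>\<^sub>E carrier G}"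

definition FI_id :: "('g, 'm) monoid_scheme \<Rightarrow> nat set \<Rightarrow> 'g FI_mor" where
  "FI_id G R = (\<lambda>i\<in>R. i, \<lambda>i\<in>R. \<one>\<^bsub>G\<^esub>)"

text \<open>\<open>FI_comp G R \<psi> \<phi>\<close> is the composite of \<open>\<phi>\<close> (with source \<open>R\<close>) followed by \<open>\<psi>\<close>.\<close>

definition FI_comp ::
  "('g, 'm) monoid_scheme \<Rightarrow> nat set \<Rightarrow> 'g FI_mor \<Rightarrow> 'g FI_mor \<Rightarrow> 'g FI_mor" where
  "FI_comp G R = (\<lambda>(b, h) (a, g). (compose R b a, \<lambda>i\<in>R. g i \<otimes>\<^bsub>G\<^esub> h (a i)))"


section \<open>Modules over the category, duals, finite generation\<close>

locale FI_module =
  fixes G :: "('g, 'm) monoid_scheme"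
    and K :: "('k, 'n) ring_scheme"
    and V :: "nat set \<Rightarrow> ('k, 'v, 'l) module_scheme"
    and T :: "nat set \<Rightarrow> nat set \<Rightarrow> 'g FI_mor \<Rightarrow> 'v \<Rightarrow> 'v"
  assumes FI_group: "group G"
    and vectorspace_obj: "finite S \<Longrightarrow> vectorspace K (V S)"
    and linear_map: "\<lbrakk>finite R; finite S; \<phi> \<in> FI_hom G R S\<rbrakk> \<Longrightarrow> T R S \<phi> \<in> module_hom K (V R) (V S)"
    and map_id: "\<lbrakk>finite S; v \<in> carrier (V S)\<rbrakk> \<Longrightarrow> T S S (FI_id G S) v = v"
    and map_comp: "\<lbrakk>finite Q; finite R; finite S; \<phi> \<in> FI_hom G Q R; \<psi> \<in> FI_hom G R S;
      v \<in> carrier (V Q)\<rbrakk> \<Longrightarrow> T Q S (FI_comp G Q \<psi> \<phi>) v = T R S \<psi> (T Q R \<phi> v)"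

definition FI_submodule ::
  "('g, 'm) monoid_scheme \<Rightarrow> ('k, 'n) ring_scheme \<Rightarrow> (nat set \<Rightarrow> ('k, 'v, 'l) module_scheme) \<Rightarrow>
   (nat set \<Rightarrow> nat set \<Rightarrow> 'g FI_mor \<Rightarrow> 'v \<Rightarrow> 'v) \<Rightarrow> (nat set \<Rightarrow> 'v set) \<Rightarrow> bool" where
  "FI_submodule G K V T N \<longleftrightarrow>
     (\<forall>S. finite S \<longrightarrow> VectorSpace.subspace K (N S) (V S)) \<and>
     (\<forall>R S \<phi>. finite R \<longrightarrow> finite S \<longrightarrow> \<phi> \<in> FI_hom G R S \<longrightarrow> T R S \<phi> ` N R \<subseteq> N S)"

locale fin_gen_FI_module = FI_module +
  assumes fin_gen: "\<exists>B. finite B \<and> (\<forall>(S, v)\<in>B. finite S \<and> v \<in> carrier (V S)) \<and>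
    (\<forall>N. FI_submodule G K V T N \<longrightarrow> (\<forall>(S, v)\<in>B. v \<in> N S) \<longrightarrow>
      (\<forall>S. finite S \<longrightarrow> N S = carrier (V S)))"

definition dual_space ::
  "('k, 'n) ring_scheme \<Rightarrow> ('k, 'v, 'l) module_scheme \<Rightarrow> ('k, 'v \<Rightarrow> 'k) module" where
  "dual_space K V = (ring.func_space K (carrier V))
     \<lparr>carrier := {f \<in> carrier V \<rightarrow>\<^sub>E carrier K.
        (\<forall>x\<in>carrier V. \<forall>y\<in>carrier V. f (x \<oplus>\<^bsub>V\<^esub> y) = f x \<oplus>\<^bsub>K\<^esub> f y) \<and>
        (\<forall>c\<in>carrier K. \<forall>x\<in>carrier V. f (c \<odot>\<^bsub>V\<^esub> x) = c \<otimes>\<^bsub>K\<^esub> f x)}\<rparr>"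

text \<open>If \<open>F R S \<phi>\<close> maps \<open>M S\<close> to \<open>M R\<close>, then \<open>dual_map M F R S \<phi>\<close> maps the dual of \<open>M R\<close> to the
  dual of \<open>M S\<close>.\<close>

definition dual_map ::
  "(nat set \<Rightarrow> ('k, 'v, 'l) module_scheme) \<Rightarrow> (nat set \<Rightarrow> nat set \<Rightarrow> 'g FI_mor \<Rightarrow> 'v \<Rightarrow> 'v) \<Rightarrow>
   nat set \<Rightarrow> nat set \<Rightarrow> 'g FI_mor \<Rightarrow> ('v \<Rightarrow> 'k) \<Rightarrow> ('v \<Rightarrow> 'k)" where
  "dual_map M F R S \<phi> f = (\<lambda>x\<in>carrier (M S). f (F R S \<phi> x))"


section \<open>Graded algebras and graded co-algebras over the category\<close>

text \<open>The grading is by a submonoid \<open>D\<close> of an additive commutative monoid; the third axiom says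
  that the algebra is the direct sum of its graded pieces.\<close>

locale graded_algebra = Module.algebra K A
  for K :: "('k, 'n) ring_scheme"
    and D :: "'j::comm_monoid_add set"
    and A :: "('k, 'a, 'l) module_scheme"
    and P :: "'j \<Rightarrow> 'a set" +
  assumes index_monoid: "0 \<in> D" "\<lbrakk>I \<in> D; J \<in> D\<rbrakk> \<Longrightarrow> I + J \<in> D"
    and piece_subspace: "J \<in> D \<Longrightarrow> VectorSpace.subspace K (P J) A"
    and direct_sum_decomp: "x \<in> carrier A \<Longrightarrow>
      \<exists>!f. f \<in> (\<Pi>\<^sub>E J\<in>D. P J) \<and> finite {J\<in>D. f J \<noteq> \<zero>\<^bsub>A\<^esub>} \<and>
        x = (\<Oplus>\<^bsub>A\<^esub>J\<in>{J\<in>D. f J \<noteq> \<zero>\<^bsub>A\<^esub>}. f J)"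
    and one_piece: "\<one>\<^bsub>A\<^esub> \<in> P 0"
    and mult_piece: "\<lbrakk>I \<in> D; J \<in> D; x \<in> P I; y \<in> P J\<rbrakk> \<Longrightarrow> x \<otimes>\<^bsub>A\<^esub> y \<in> P (I + J)"

definition graded_algebra_hom ::
  "('k, 'n) ring_scheme \<Rightarrow> 'j set \<Rightarrow> ('k, 'a, 'l) module_scheme \<Rightarrow> ('j \<Rightarrow> 'a set) \<Rightarrow>
   ('k, 'b, 'm) module_scheme \<Rightarrow> ('j \<Rightarrow> 'b set) \<Rightarrow> ('a \<Rightarrow> 'b) set" where
  "graded_algebra_hom K D A P B Q =
     {f \<in> ring_hom A B \<inter> module_hom K A B. \<forall>J\<in>D. f ` P J \<subseteq> Q J}"

locale graded_co_FI_algebra =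
  fixes G :: "('g, 'm) monoid_scheme"
    and K :: "('k, 'n) ring_scheme"
    and D :: "'j::comm_monoid_add set"
    and A :: "nat set \<Rightarrow> ('k, 'a, 'l) module_scheme"
    and P :: "nat set \<Rightarrow> 'j \<Rightarrow> 'a set"
    and F :: "nat set \<Rightarrow> nat set \<Rightarrow> 'g FI_mor \<Rightarrow> 'a \<Rightarrow> 'a"
  assumes FI_group: "group G"
    and base_field: "field K"
    and graded_algebra_obj: "finite S \<Longrightarrow> graded_algebra K D (A S) (P S)"
    and graded_hom: "\<lbrakk>finite R; finite S; \<phi> \<in> FI_hom G R S\<rbrakk> \<Longrightarrow>
      F R S \<phi> \<in> graded_algebra_hom K D (A S) (P S) (A R) (P R)"
    and map_id: "\<lbrakk>finite S; x \<in> carrier (A S)\<rbrakk> \<Longrightarrow> F S S (FI_id G S) x = x"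
    and map_comp: "\<lbrakk>finite Q; finite R; finite S; \<phi> \<in> FI_hom G Q R; \<psi> \<in> FI_hom G R S;
      x \<in> carrier (A S)\<rbrakk> \<Longrightarrow> F Q S (FI_comp G Q \<psi> \<phi>) x = F Q R \<phi> (F R S \<psi> x)"
begin

definition piece :: "'j \<Rightarrow> nat set \<Rightarrow> ('k, 'a, 'l) module_scheme" where
  "piece J S = (A S)\<lparr>carrier := P S J\<rparr>"

end

locale finite_type_graded_co_FI_algebra = graded_co_FI_algebra +
  assumes piece_fin_dim: "\<lbrakk>J \<in> D; finite S\<rbrakk> \<Longrightarrow> vectorspace.fin_dim K (piece J S)"
    and piece_fin_gen: "J \<in> D \<Longrightarrow>
      fin_gen_FI_module G K (\<lambda>S. dual_space K (piece J S)) (dual_map (piece J) F)"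


section \<open>Polynomial rings in r sets of variables\<close>

text \<open>The variable indexed by the pair \<open>(s, j)\<close> is the one written $x_j^{(s)}$.\<close>

type_synonym 'k mpoly = "(nat \<times> nat \<Rightarrow>\<^sub>0 nat) \<Rightarrow>\<^sub>0 'k"

definition Var :: "nat \<Rightarrow> nat \<Rightarrow> 'k::comm_ring_1 mpoly" where
  "Var s j = Poly_Mapping.single (Poly_Mapping.single (s, j) 1) 1"

definition Const :: "'k::comm_ring_1 \<Rightarrow> 'k mpoly" where
  "Const c = Poly_Mapping.single 0 c"

definition poly_alg :: "nat \<Rightarrow> nat set \<Rightarrow> ('k::comm_ring_1, 'k mpoly) module" where
  "poly_alg r S =
     \<lparr>carrier = {p. \<forall>m\<in>Poly_Mapping.keys p. Poly_Mapping.keys m \<subseteq> {1..r} \<times> S},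
      monoid.mult = (*), one = 1, ring.zero = 0, add = (+), module.smult = (\<lambda>c p. Const c * p)\<rparr>"

text \<open>The algebra homomorphism sending the variable indexed by \<open>v\<close> to \<open>e v\<close>.\<close>

definition poly_subst :: "(nat \<times> nat \<Rightarrow> 'k::comm_ring_1 mpoly) \<Rightarrow> 'k mpoly \<Rightarrow> 'k mpoly" where
  "poly_subst e p = (\<Sum>m\<in>Poly_Mapping.keys p. Const (Poly_Mapping.lookup p m) *
     (\<Prod>v\<in>Poly_Mapping.keys m. e v ^ Poly_Mapping.lookup m v))"

definition multidegrees :: "nat \<Rightarrow> (nat \<Rightarrow>\<^sub>0 nat) set" where
  "multidegrees r = {J. Poly_Mapping.keys J \<subseteq> {1..r}}"

definition homogeneous :: "(nat \<Rightarrow>\<^sub>0 nat) \<Rightarrow> 'k::comm_ring_1 mpoly \<Rightarrow> bool" where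
  "homogeneous J p \<longleftrightarrow> (\<forall>m\<in>Poly_Mapping.keys p. \<forall>s.
     (\<Sum>j\<in>{j. (s, j) \<in> Poly_Mapping.keys m}. Poly_Mapping.lookup m (s, j)) = Poly_Mapping.lookup J s)"


section \<open>Diagonal coinvariant algebras\<close>

definition primitive_root :: "nat \<Rightarrow> 'k::field \<Rightarrow> bool" where
  "primitive_root d \<zeta> \<longleftrightarrow> \<zeta> ^ d = 1 \<and> (\<forall>e. 0 < e \<and> e < d \<longrightarrow> \<zeta> ^ e \<noteq> 1)"

text \<open>For a morphism \<open>\<phi> = (a, g)\<close> from \<open>R\<close> to \<open>S\<close> over the group of integers modulo \<open>d\<close>, this is the
  matrix of the map $k^R \to k^S$, $e_j \mapsto \zeta^{g_j} e_{a(j)}$.\<close>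

definition FI_matrix :: "'k::field \<Rightarrow> int FI_mor \<Rightarrow> nat \<Rightarrow> nat \<Rightarrow> 'k" where
  "FI_matrix \<zeta> = (\<lambda>(a, g) i j. if i = a j then \<zeta> ^ nat (g j) else 0)"

text \<open>Composition of polynomial functions on \<open>r\<close> copies of $k^S$ with that map.\<close>

definition pullback :: "'k::field \<Rightarrow> nat set \<Rightarrow> int FI_mor \<Rightarrow> 'k mpoly \<Rightarrow> 'k mpoly" where
  "pullback \<zeta> R \<phi> = poly_subst (\<lambda>(s, i). \<Sum>j\<in>R. Const (FI_matrix \<zeta> \<phi> i j) * Var s j)"

definition wreath :: "('g, 'm) monoid_scheme \<Rightarrow> nat set \<Rightarrow> 'g FI_mor monoid" where
  "wreath G S = \<lparr>carrier = Bij S \<times> (S \<rightarrow>\<^sub>E carrier G), monoid.mult = FI_comp G S, one = FI_id G S\<rparr>"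

text \<open>The left action of \<open>w\<close> on polynomials is the pullback along the inverse of \<open>w\<close>; as \<open>w\<close> ranges
  over the whole group, the inverse does not change the set of invariants.\<close>

definition invariants :: "'k::field \<Rightarrow> nat \<Rightarrow> nat \<Rightarrow> nat set \<Rightarrow> 'k mpoly set" where
  "invariants \<zeta> d r S = {p \<in> carrier (poly_alg r S).
     \<forall>w\<in>carrier (wreath (integer_mod_group d) S). pullback \<zeta> S w p = p}"

definition coinv_ideal :: "'k::field \<Rightarrow> nat \<Rightarrow> nat \<Rightarrow> nat set \<Rightarrow> 'k mpoly set" where
  "coinv_ideal \<zeta> d r S =
     Idl\<^bsub>poly_alg r S\<^esub> {p \<in> invariants \<zeta> d r S. Poly_Mapping.lookup p 0 = 0}"

definition coinv_class :: "'k::field \<Rightarrow> nat \<Rightarrow> nat \<Rightarrow> nat set \<Rightarrow> 'k mpoly \<Rightarrow> 'k mpoly set" where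
  "coinv_class \<zeta> d r S p = coinv_ideal \<zeta> d r S +>\<^bsub>poly_alg r S\<^esub> p"

text \<open>Operations induced on the quotient are written in the style of \<^const>\<open>rcoset_mult\<close>, as unions
  over all representatives of a coset.\<close>

definition coinv_alg :: "'k::field \<Rightarrow> nat \<Rightarrow> nat \<Rightarrow> nat set \<Rightarrow> ('k, 'k mpoly set) module" where
  "coinv_alg \<zeta> d r S = ring.extend (poly_alg r S Quot coinv_ideal \<zeta> d r S)
     (module.fields (\<lambda>c Y. \<Union>p\<in>Y. coinv_class \<zeta> d r S (c \<odot>\<^bsub>poly_alg r S\<^esub> p)))"

definition coinv_piece ::
  "'k::field \<Rightarrow> nat \<Rightarrow> nat \<Rightarrow> nat set \<Rightarrow> (nat \<Rightarrow>\<^sub>0 nat) \<Rightarrow> 'k mpoly set set" where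
  "coinv_piece \<zeta> d r S J =
     coinv_class \<zeta> d r S ` {p \<in> carrier (poly_alg r S). homogeneous J p}"

definition coinv_map ::
  "'k::field \<Rightarrow> nat \<Rightarrow> nat \<Rightarrow> nat set \<Rightarrow> nat set \<Rightarrow> int FI_mor \<Rightarrow> 'k mpoly set \<Rightarrow> 'k mpoly set" where
  "coinv_map \<zeta> d r R S \<phi> Y = (\<Union>p\<in>Y. coinv_class \<zeta> d r R (pullback \<zeta> R \<phi> p))"

lemma Const_one: "Const 1 = 1"
  by (simp add: Const_def)

lemma poly_subst_Var: "poly_subst e (Var s j) = e (s, j)"
  by (simp add: poly_subst_def Var_def Const_one)

lemma Const_zero: "Const 0 = 0"
  by (simp add: Const_def)

text \<open>On variables, the pullback along \<open>(a, g)\<close> is $x_{a(j)}^{(s)} \mapsto \zeta^{g_j} x_j^{(s)}$, and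
  $x_l^{(s)} \mapsto 0$ for \<open>l\<close> outside the image of \<open>a\<close>.\<close>

lemma pullback_Var_image:
  assumes "finite R" "(a, g) \<in> FI_hom (integer_mod_group d) R S" "j \<in> R"
  shows "pullback \<zeta> R (a, g) (Var s (a j)) = Const (\<zeta> ^ nat (g j)) * Var s j"
proof -
  have inj: "inj_on a R"
    using assms by (simp add: FI_hom_def)
  have "pullback \<zeta> R (a, g) (Var s (a j)) =
      (\<Sum>i\<in>R. if i = j then Const (\<zeta> ^ nat (g j)) * Var s j else 0)"
    unfolding pullback_def poly_subst_Var FI_matrix_def prod.case
    by (intro sum.cong refl) (use inj assms(3) in \<open>auto simp: Const_zero dest: inj_onD\<close>)
  also have "\<dots> = Const (\<zeta> ^ nat (g j)) * Var s j"
    using assms by simp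
  finally show ?thesis .
qed

lemma pullback_Var_not_image:
  assumes "l \<notin> a ` R"
  shows "pullback \<zeta> R (a, g) (Var s l) = 0"
  unfolding pullback_def poly_subst_Var FI_matrix_def prod.case
  using assms by (intro sum.neutral) (auto simp: Const_zero)

lemma group_wreath:
  assumes "group G"
  shows "group (wreath G S)"
proof -
  interpret group G by fact
  show ?thesis
  proof (rule groupI)
    fix x y assume "x \<in> carrier (wreath G S)" "y \<in> carrier (wreath G S)"
    then obtain a g b h where "x = (a, g)" "y = (b, h)" and ab: "a \<in> Bij S" "b \<in> Bij S"
      and gh: "g \<in> S \<rightarrow>\<^sub>E carrier G" "h \<in> S \<rightarrow>\<^sub>E carrier G"
      by (auto simp: wreath_def)
    then show "x \<otimes>\<^bsub>wreath G S\<^esub> y \<in> carrier (wreath G S)"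
      using compose_Bij[OF ab] Bij_imp_funcset[OF ab(2)] by (auto simp: wreath_def FI_comp_def)
  next
    show "\<one>\<^bsub>wreath G S\<^esub> \<in> carrier (wreath G S)"
      by (auto simp: wreath_def FI_id_def id_Bij)
  next
    fix x y z
    assume "x \<in> carrier (wreath G S)" "y \<in> carrier (wreath G S)" "z \<in> carrier (wreath G S)"
    then obtain a f b g c h where xyz: "x = (a, f)" "y = (b, g)" "z = (c, h)"
      and "b \<in> Bij S" "c \<in> Bij S"
      and fgh: "f \<in> S \<rightarrow>\<^sub>E carrier G" "g \<in> S \<rightarrow>\<^sub>E carrier G" "h \<in> S \<rightarrow>\<^sub>E carrier G"
      by (auto simp: wreath_def)
    then have bc: "i \<in> S \<Longrightarrow> b i \<in> S" "i \<in> S \<Longrightarrow> c i \<in> S" for i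
      by (auto dest!: Bij_imp_funcset)
    show "x \<otimes>\<^bsub>wreath G S\<^esub> y \<otimes>\<^bsub>wreath G S\<^esub> z = x \<otimes>\<^bsub>wreath G S\<^esub> (y \<otimes>\<^bsub>wreath G S\<^esub> z)"
      using fgh bc by (auto simp: xyz wreath_def FI_comp_def compose_def fun_eq_iff
          restrict_def PiE_iff m_assoc)
  next
    fix x assume "x \<in> carrier (wreath G S)"
    then obtain a g where x: "x = (a, g)" and a: "a \<in> Bij S" and g: "g \<in> S \<rightarrow>\<^sub>E carrier G"
      by (auto simp: wreath_def)
    have "a i \<in> S" if "i \<in> S" for i
      using a that by (auto dest!: Bij_imp_funcset)
    then show "\<one>\<^bsub>wreath G S\<^esub> \<otimes>\<^bsub>wreath G S\<^esub> x = x"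
      using g Bij_imp_extensional[OF a] by (auto simp: x wreath_def FI_comp_def FI_id_def compose_def
          fun_eq_iff restrict_def PiE_iff extensional_def)
  next
    fix x assume "x \<in> carrier (wreath G S)"
    then obtain a g where x: "x = (a, g)" and a: "a \<in> Bij S" and g: "g \<in> S \<rightarrow>\<^sub>E carrier G"
      by (auto simp: wreath_def)
    let ?b = "\<lambda>i\<in>S. inv_into S a i"
    have b: "?b \<in> Bij S" using a by (rule restrict_inv_into_Bij)
    have ba: "i \<in> S \<Longrightarrow> a i \<in> S" "i \<in> S \<Longrightarrow> inv_into S a (a i) = i"
      "i \<in> S \<Longrightarrow> inv_into S a i \<in> S" for i
      using a by (auto simp: Bij_def bij_betw_def inv_into_into)
    have "(?b, \<lambda>i\<in>S. inv\<^bsub>G\<^esub> g (?b i)) \<in> carrier (wreath G S)"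
      using b g ba by (auto simp: wreath_def)
    moreover have "(?b, \<lambda>i\<in>S. inv\<^bsub>G\<^esub> g (?b i)) \<otimes>\<^bsub>wreath G S\<^esub> x = \<one>\<^bsub>wreath G S\<^esub>"
      using g ba by (auto simp: x wreath_def FI_comp_def FI_id_def compose_def fun_eq_iff restrict_def
          PiE_iff)
    ultimately show "\<exists>y\<in>carrier (wreath G S). y \<otimes>\<^bsub>wreath G S\<^esub> x = \<one>\<^bsub>wreath G S\<^esub>"
      by blast
  qed
qed

end

theory Submission
  imports Defs "HOL-Library.Product_Lexorder" "HOL-Library.Infinite_Set"
begin

text \<open>
  A morphism from \<open>R\<close> to \<open>S\<close> pulls polynomials back, and every automorphism of \<open>R\<close> extends along it to
  an automorphism of \<open>S\<close> (\<open>wreath_extend\<close>).  Hence invariants pull back to invariants, coinvariant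
  ideals pull back into coinvariant ideals, and the quotients form a functor.  Pullback preserves
  multidegrees, so the homogeneous components of an invariant are invariant, the coinvariant ideal is
  homogeneous (\<open>component_coinv_ideal\<close>) and the quotient is graded.  A graded piece is spanned by the
  classes of the finitely many monomials of its multidegree.

  The remaining point is finite generation of the duals of the graded pieces.  It is proved, in every
  characteristic, by a Groebner basis argument for linear functionals on the piece of multidegree
  \<open>J\<close>.  A functional is determined by its values on monomials, and its lead monomial is the largest
  monomial on which it does not vanish.  A monomial on \<open>S\<close> is a word with one letter, the column of
  its exponents, for each element of \<open>S\<close>.  An increasing injection with trivial labels inserts zero
  letters into the lead word of a functional (\<open>dual_map_lead_monomial\<close>), because the monomial order is
  compatible with such injections (\<open>pull_monomial_strict_mono\<close>).  The multidegree bounds both the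
  letters and the number of letters that are not zero, and on such words the insertion of zeros is a
  well-quasi-order (\<open>pad_chain\<close>).  So there are finitely many functionals whose lead words lie below
  all lead words (\<open>leading_terms_finite_basis\<close>).  Subtracting multiples of their images from a given
  functional lowers its lead monomial until nothing is left (\<open>functional_in_submodule\<close>); so they
  generate.
\<close>

section \<open>Words and the insertion of zero letters\<close>

lemma constant_subsequence:
  fixes f :: "nat \<Rightarrow> 'a"
  assumes "finite U" "\<And>i. f i \<in> U"
  obtains c \<phi> where "c \<in> U" "strict_mono (\<phi> :: nat \<Rightarrow> nat)" "\<And>i. f (\<phi> i) = c"
proof -
  have "finite (range f)"
    using assms by (meson finite_subset image_subsetI)
  then obtain k where k: "infinite {i. f i = f k}"
    using pigeonhole_infinite[of UNIV f] by auto
  show thesis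
  proof (rule that[of "f k" "enumerate {i. f i = f k}"])
    show "f (enumerate {i. f i = f k} i) = f k" for i
      using enumerate_in_set[OF k, of i] by simp
  qed (use assms k in \<open>auto intro: strict_mono_enumerate\<close>)
qed

lemma nondecreasing_subsequence:
  fixes f :: "nat \<Rightarrow> nat"
  obtains \<phi> where "strict_mono (\<phi> :: nat \<Rightarrow> nat)" "\<And>i j. i < j \<Longrightarrow> f (\<phi> i) \<le> f (\<phi> j)"
proof -
  obtain \<phi> :: "nat \<Rightarrow> nat" where \<phi>: "strict_mono \<phi>" "monoseq (\<lambda>n. f (\<phi> n))"
    using seq_monosub by blast
  show thesis
  proof (cases "\<forall>m. \<forall>n\<ge>m. f (\<phi> m) \<le> f (\<phi> n)")
    case True
    then show thesis using \<phi> by (intro that[of \<phi>]) auto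
  next
    case False
    \<comment> \<open>A nonincreasing sequence of natural numbers takes finitely many values.\<close>
    with \<phi> have "f (\<phi> n) \<in> {..f (\<phi> 0)}" for n
      unfolding monoseq_def by blast
    then obtain c \<psi> where \<psi>: "strict_mono (\<psi> :: nat \<Rightarrow> nat)" "\<And>i. f (\<phi> (\<psi> i)) = c"
      using constant_subsequence[OF finite_atMost, of "\<lambda>n. f (\<phi> n)"] by metis
    show thesis
      using \<phi> \<psi> by (intro that[of "\<phi> \<circ> \<psi>"]) (auto simp: strict_mono_def)
  qed
qed

text \<open>
  If no finite subset of \<open>U\<close> were a basis, one could choose elements of
  \<open>U\<close> one after the other, none of them above an earlier one.
\<close>

lemma finite_basis_if_no_bad_sequence:
  fixes U :: "'a set"
  assumes good: "\<And>s :: nat \<Rightarrow> 'a. (\<And>i. s i \<in> U) \<Longrightarrow> \<exists>i j. i < j \<and> R (s i) (s j)"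
  obtains B where "finite B" "B \<subseteq> U" "\<And>x. x \<in> U \<Longrightarrow> \<exists>b\<in>B. R b x"
proof (rule ccontr)
  note basis = that
  assume "\<not> thesis"
  then have *: "\<exists>x\<in>U. \<forall>b\<in>B. \<not> R b x" if "finite B" "B \<subseteq> U" for B
    using basis[OF that] by blast
  have "\<exists>s :: nat \<Rightarrow> 'a. \<forall>n. s n \<in> U \<and> (\<forall>i<n. \<not> R (s i) (s n))"
  proof (rule dependent_wellorder_choice[where P = "\<lambda>s n x. x \<in> U \<and> (\<forall>i<n. \<not> R (s i) x)"])
    fix s :: "nat \<Rightarrow> 'a" and n
    assume "\<And>i. i < n \<Longrightarrow> s i \<in> U \<and> (\<forall>j<i. \<not> R (s j) (s i))"
    then show "\<exists>x. x \<in> U \<and> (\<forall>i<n. \<not> R (s i) x)"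
      using *[of "s ` {..<n}"] by blast
  qed simp
  then show False
    using good by blast
qed

text \<open>
  The zero letter \<open>z\<close> may be inserted at any place, other letters may not, so fewer
  words are comparable than in the subword order.  This relation describes how increasing
  injections act on the words of monomials.
\<close>

inductive pad :: "'c \<Rightarrow> 'c list \<Rightarrow> 'c list \<Rightarrow> bool" for z where
  pad_Nil: "pad z [] []"
| pad_Cons: "pad z u v \<Longrightarrow> pad z (x # u) (x # v)"
| pad_insert: "pad z u v \<Longrightarrow> pad z u (z # v)"

lemma pad_replicate: "n \<le> m \<Longrightarrow> pad z u v \<Longrightarrow> pad z (replicate n z @ u) (replicate m z @ v)"
proof (induction m arbitrary: n)
  case (Suc m)
  then show ?case
    using Suc.IH[of 0] by (cases n) (auto intro: pad.intros)
qed auto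

lemma split_at_first_letter:
  "filter (\<lambda>x. x \<noteq> z) w \<noteq> [] \<Longrightarrow> \<exists>n c v. w = replicate n z @ c # v \<and>
    filter (\<lambda>x. x \<noteq> z) w = c # filter (\<lambda>x. x \<noteq> z) v"
proof (induction w)
  case (Cons x w)
  show ?case
  proof (cases "x = z")
    case True
    with Cons.prems have "filter (\<lambda>x. x \<noteq> z) w \<noteq> []"
      by simp
    from Cons.IH[OF this] obtain n c v where "w = replicate n z @ c # v"
      "filter (\<lambda>x. x \<noteq> z) w = c # filter (\<lambda>x. x \<noteq> z) v"
      by blast
    then have "x # w = replicate (Suc n) z @ c # v \<and>
        filter (\<lambda>x. x \<noteq> z) (x # w) = c # filter (\<lambda>x. x \<noteq> z) v"
      using True by simp
    then show ?thesis by blast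
  next
    case False
    then have "x # w = replicate 0 z @ x # w \<and>
        filter (\<lambda>x. x \<noteq> z) (x # w) = x # filter (\<lambda>x. x \<noteq> z) w"
      by simp
    then show ?thesis by blast
  qed
qed simp

text \<open>
  Induction on the number \<open>N\<close> of letters other than \<open>z\<close>.  A word with
  \<open>N + 1\<close> such letters has the form \<open>replicate n z @ c # v\<close>, and one
  passes to subsequences along which \<open>n\<close> is nondecreasing, then \<open>c\<close> is
  constant, then the words \<open>v\<close> form a chain.  Asking for a chain and not just for
  one comparable pair is what makes these three choices compatible.
\<close>

lemma pad_chain:
  assumes "finite C" "\<And>i. set (w i) \<subseteq> C" "\<And>i. length (filter (\<lambda>x. x \<noteq> z) (w i)) = N"
  shows "\<exists>\<phi> :: nat \<Rightarrow> nat. strict_mono \<phi> \<and> (\<forall>i j. i < j \<longrightarrow> pad z (w (\<phi> i)) (w (\<phi> j)))"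
  using assms(2,3)
proof (induction N arbitrary: w)
  case 0
  have w: "w i = replicate (length (w i)) z" for i
    using "0.prems"(2)[of i] by (simp add: filter_empty_conv replicate_length_same)
  obtain \<phi> :: "nat \<Rightarrow> nat" where \<phi>: "strict_mono \<phi>"
    "\<And>i j. i < j \<Longrightarrow> length (w (\<phi> i)) \<le> length (w (\<phi> j))"
    by (rule nondecreasing_subsequence[of "\<lambda>i. length (w i)"]) blast
  have "pad z (w (\<phi> i)) (w (\<phi> j))" if "i < j" for i j
    using pad_replicate[OF \<phi>(2)[OF that] pad_Nil, of z] by (simp flip: w)
  then show ?case
    using \<phi>(1) by blast
next
  case (Suc N)
  have "\<exists>n c v. w i = replicate n z @ c # v \<and> length (filter (\<lambda>x. x \<noteq> z) v) = N" for i
  proof -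
    have "filter (\<lambda>x. x \<noteq> z) (w i) \<noteq> []"
      using Suc.prems(2)[of i] by auto
    from split_at_first_letter[OF this] show ?thesis
      using Suc.prems(2)[of i] by fastforce
  qed
  then obtain n c v where w: "\<And>i. w i = replicate (n i) z @ c i # v i"
    and v: "\<And>i. length (filter (\<lambda>x. x \<noteq> z) (v i)) = N"
    by metis
  have sub: "c i \<in> C" "set (v i) \<subseteq> C" for i
    using Suc.prems(1)[of i] by (auto simp: w)
  obtain \<phi>1 :: "nat \<Rightarrow> nat" where 1: "strict_mono \<phi>1" "\<And>i j. i < j \<Longrightarrow> n (\<phi>1 i) \<le> n (\<phi>1 j)"
    by (rule nondecreasing_subsequence[of n]) blast
  obtain \<phi>2 :: "nat \<Rightarrow> nat" and x where 2: "strict_mono \<phi>2" "\<And>i. c (\<phi>1 (\<phi>2 i)) = x"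
    by (rule constant_subsequence[OF assms(1), of "\<lambda>i. c (\<phi>1 i)"]) (use sub(1) in blast)+
  have "\<exists>\<phi> :: nat \<Rightarrow> nat. strict_mono \<phi> \<and> (\<forall>i j. i < j \<longrightarrow> pad z (v (\<phi>1 (\<phi>2 (\<phi> i)))) (v (\<phi>1 (\<phi>2 (\<phi> j)))))"
    by (rule Suc.IH[of "\<lambda>i. v (\<phi>1 (\<phi>2 i))"]) (fact sub v)+
  then obtain \<phi>3 :: "nat \<Rightarrow> nat" where 3: "strict_mono \<phi>3"
    "\<And>i j. i < j \<Longrightarrow> pad z (v (\<phi>1 (\<phi>2 (\<phi>3 i)))) (v (\<phi>1 (\<phi>2 (\<phi>3 j))))"
    by blast
  have "pad z (w (\<phi>1 (\<phi>2 (\<phi>3 i)))) (w (\<phi>1 (\<phi>2 (\<phi>3 j))))" if "i < j" for i j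
  proof -
    have "n (\<phi>1 (\<phi>2 (\<phi>3 i))) \<le> n (\<phi>1 (\<phi>2 (\<phi>3 j)))"
      using 1(2) 2(1) 3(1) that by (simp add: strict_mono_def)
    then show ?thesis
      unfolding w 2(2) using 3(2)[OF that] by (intro pad_replicate pad_Cons)
  qed
  moreover have "strict_mono (\<lambda>i. \<phi>1 (\<phi>2 (\<phi>3 i)))"
    using 1(1) 2(1) 3(1) by (simp add: strict_mono_def)
  ultimately show ?case
    by (intro exI[of _ "\<lambda>i. \<phi>1 (\<phi>2 (\<phi>3 i))"]) blast
qed

lemma pad_finite_basis:
  assumes "finite C" and U: "\<And>x. x \<in> U \<Longrightarrow> set (w x) \<subseteq> C"
    "\<And>x. x \<in> U \<Longrightarrow> length (filter (\<lambda>c. c \<noteq> z) (w x)) \<le> N"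
  shows "\<exists>B. finite B \<and> B \<subseteq> U \<and> (\<forall>x\<in>U. \<exists>b\<in>B. pad z (w b) (w x))"
proof (rule finite_basis_if_no_bad_sequence[of U "\<lambda>b x. pad z (w b) (w x)"])
  fix s :: "nat \<Rightarrow> _" assume s: "\<And>i. s i \<in> U"
  have "length (filter (\<lambda>c. c \<noteq> z) (w (s i))) \<in> {..N}" for i
    using s U(2) by simp
  then obtain \<phi> :: "nat \<Rightarrow> nat" and k where 1: "strict_mono \<phi>"
    "\<And>i. length (filter (\<lambda>c. c \<noteq> z) (w (s (\<phi> i)))) = k"
    by (rule constant_subsequence[OF finite_atMost, of "\<lambda>i. length (filter (\<lambda>c. c \<noteq> z) (w (s i)))"])
      blast+
  have "\<exists>\<psi> :: nat \<Rightarrow> nat. strict_mono \<psi> \<and> (\<forall>i j. i < j \<longrightarrow> pad z (w (s (\<phi> (\<psi> i)))) (w (s (\<phi> (\<psi> j)))))"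
    by (rule pad_chain[OF assms(1)]) (use U(1) s 1(2) in blast)+
  then obtain \<psi> :: "nat \<Rightarrow> nat" where 2: "strict_mono \<psi>"
    "\<And>i j. i < j \<Longrightarrow> pad z (w (s (\<phi> (\<psi> i)))) (w (s (\<phi> (\<psi> j))))"
    by blast
  have "\<phi> (\<psi> 0) < \<phi> (\<psi> 1)"
    using 1(1) 2(1) by (simp add: strict_mono_def)
  then show "\<exists>i j. i < j \<and> pad z (w (s i)) (w (s j))"
    using 2(2)[of 0 1] by auto
qed blast

text \<open>
  Each letter of the shorter word keeps its place among the letters of the longer one, which
  defines \<open>a\<close>; the positions outside the image of \<open>a\<close> carry inserted
  zeros.
\<close>

lemma pad_imp_increasing_map:
  fixes xs ys :: "nat list"
  assumes "pad z (map f xs) (map g ys)" "sorted_wrt (<) xs" "sorted_wrt (<) ys"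
  shows "\<exists>a. a \<in> set xs \<rightarrow> set ys \<and> strict_mono_on (set xs) a \<and>
    (\<forall>x\<in>set xs. g (a x) = f x) \<and> (\<forall>y\<in>set ys - a ` set xs. g y = z)"
  using assms
proof (induction "map f xs" "map g ys" arbitrary: xs ys rule: pad.induct)
  case pad_Nil
  then show ?case by (simp add: strict_mono_on_def)
next
  case (pad_Cons u v c)
  obtain x xs' where xs: "xs = x # xs'" "f x = c" "u = map f xs'"
    using pad_Cons.hyps(3) by (cases xs) auto
  obtain y ys' where ys: "ys = y # ys'" "g y = c" "v = map g ys'"
    using pad_Cons.hyps(4) by (cases ys) auto
  have "sorted_wrt (<) xs'" "sorted_wrt (<) ys'"
    using pad_Cons.prems xs(1) ys(1) by simp_all
  from pad_Cons.hyps(2)[OF xs(3) ys(3) this] obtain a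
    where a: "a \<in> set xs' \<rightarrow> set ys'" "strict_mono_on (set xs') a"
    "\<forall>x\<in>set xs'. g (a x) = f x" "\<forall>y\<in>set ys' - a ` set xs'. g y = z"
    by blast
  have new: "x' > x" "a x' > y" "a x' \<in> set ys'" if "x' \<in> set xs'" for x'
    using that a(1) pad_Cons.prems xs(1) ys(1) by auto
  then have x: "x \<notin> set xs'" by blast
  let ?a = "a(x := y)"
  have "?a \<in> set xs \<rightarrow> set ys"
    using a(1) xs(1) ys(1) by (auto simp: Pi_iff)
  moreover have "strict_mono_on (set xs) ?a"
    unfolding strict_mono_on_def
  proof (intro allI impI)
    fix p q assume pq: "p \<in> set xs \<and> q \<in> set xs \<and> p < q"
    then have "q \<in> set xs'" "q \<noteq> x"
      using new(1)[of p] xs(1) by auto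
    then show "?a p < ?a q"
      using pq new(2)[of q] strict_mono_onD[OF a(2), of p q] xs(1) by (cases "p = x") auto
  qed
  moreover have "\<forall>p\<in>set xs. g (?a p) = f p"
    using xs ys a(3) by simp
  moreover have "\<forall>q\<in>set ys - ?a ` set xs. g q = z"
  proof
    fix q assume q: "q \<in> set ys - ?a ` set xs"
    have "?a ` set xs = insert y (a ` set xs')"
      using x xs(1) by (auto simp: image_iff)
    then have "q \<in> set ys' - a ` set xs'"
      using q ys(1) by simp
    then show "g q = z" using a(4) by blast
  qed
  ultimately show ?case by blast
next
  case (pad_insert v)
  obtain y ys' where ys: "ys = y # ys'" "g y = z" "v = map g ys'"
    using pad_insert.hyps(3) by (cases ys) auto
  have "sorted_wrt (<) ys'"
    using pad_insert.prems ys(1) by simp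
  from pad_insert.hyps(2)[OF refl ys(3) pad_insert.prems(1) this]
  show ?case
    using ys(1,2) by fastforce
qed

section \<open>Substitution in polynomials\<close>

abbreviation lookup where "lookup \<equiv> Poly_Mapping.lookup"
abbreviation keys where "keys \<equiv> Poly_Mapping.keys"
abbreviation single where "single \<equiv> Poly_Mapping.single"

lemma Const_mult: "Const a * Const b = Const (a * b)"
  by (simp add: Const_def mult_single)

lemma Const_add: "Const a + Const b = Const (a + b)"
  by (simp add: Const_def single_add)

lemma Const_mult_single: "Const a * single m b = single m (a * b)"
  by (simp add: Const_def mult_single)

lemma Const_sum: "Const (sum f I) = (\<Sum>i\<in>I. Const (f i))"
  by (induction I rule: infinite_finite_induct) (simp_all add: Const_zero flip: Const_add)

lemma lookup_Const_mult: "lookup (Const c * p) m = c * lookup p m"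
  unfolding Const_def
proof (induction p rule: update_induct)
  case const
  then show ?case by simp
next
  case (update p k b)
  have "Poly_Mapping.update k b p = p + single k b"
    using update by (intro poly_mapping_eqI) (auto simp: lookup_update lookup_add lookup_single when_def in_keys_iff)
  then show ?case
    using update.IH by (simp add: algebra_simps mult_single lookup_add lookup_single when_def)
qed

lemma keys_Const_mult: "keys (Const c * p) \<subseteq> keys p"
  by (auto simp: in_keys_iff lookup_Const_mult)

lemma sum_single: "(\<Sum>m\<in>keys p. single m (lookup p m)) = p"
  by (intro poly_mapping_eqI)
     (auto simp: lookup_sum lookup_single when_def in_keys_iff)

lemma mult_eq_sum_single:
  "p * q = (\<Sum>m\<in>keys p. \<Sum>n\<in>keys q. single (m + n) (lookup p m * lookup q n))"
proof -
  have "p * q = (\<Sum>m\<in>keys p. single m (lookup p m)) * (\<Sum>n\<in>keys q. single n (lookup q n))"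
    by (simp only: sum_single)
  then show ?thesis
    by (simp add: sum_product mult_single)
qed

definition subst_monom :: "('v \<Rightarrow> 'a::comm_monoid_mult) \<Rightarrow> ('v \<Rightarrow>\<^sub>0 nat) \<Rightarrow> 'a" where
  "subst_monom e m = (\<Prod>v\<in>keys m. e v ^ lookup m v)"

lemma subst_monom_superset:
  assumes "finite V" "keys m \<subseteq> V"
  shows "subst_monom e m = (\<Prod>v\<in>V. e v ^ lookup m v)"
  unfolding subst_monom_def
  using assms by (intro prod.mono_neutral_left) (auto simp: in_keys_iff)

lemma subst_monom_zero [simp]: "subst_monom e 0 = 1"
  by (simp add: subst_monom_def)

lemma subst_monom_add: "subst_monom e (m + n) = subst_monom e m * subst_monom e n"
proof -
  let ?V = "keys m \<union> keys n"
  have "subst_monom e (m + n) = (\<Prod>v\<in>?V. e v ^ lookup (m + n) v)"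
    by (rule subst_monom_superset) (auto dest: subsetD[OF keys_add])
  also have "\<dots> = (\<Prod>v\<in>?V. e v ^ lookup m v) * (\<Prod>v\<in>?V. e v ^ lookup n v)"
    by (simp add: lookup_add power_add prod.distrib)
  finally show ?thesis
    by (simp add: subst_monom_superset[of ?V])
qed

lemma poly_subst_superset:
  assumes "finite M" "keys p \<subseteq> M"
  shows "poly_subst e p = (\<Sum>m\<in>M. Const (lookup p m) * subst_monom e m)"
  unfolding poly_subst_def subst_monom_def
  using assms by (intro sum.mono_neutral_left) (auto simp: in_keys_iff Const_zero)

lemma poly_subst_single: "poly_subst e (single m c) = Const c * subst_monom e m"
  by (simp add: poly_subst_superset[of "{m}"])

lemma poly_subst_0 [simp]: "poly_subst e 0 = 0"
  by (simp add: poly_subst_def)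

lemma poly_subst_Const [simp]: "poly_subst e (Const c) = Const c"
  by (simp add: Const_def poly_subst_single)

lemma poly_subst_1 [simp]: "poly_subst e 1 = 1"
  using poly_subst_Const[of e 1] by (simp only: Const_one)

lemma poly_subst_add: "poly_subst e (p + q) = poly_subst e p + poly_subst e q"
proof -
  let ?M = "keys p \<union> keys q"
  have "poly_subst e (p + q) = (\<Sum>m\<in>?M. Const (lookup (p + q) m) * subst_monom e m)"
    by (rule poly_subst_superset) (auto dest: subsetD[OF keys_add])
  also have "\<dots> = (\<Sum>m\<in>?M. Const (lookup p m) * subst_monom e m) + (\<Sum>m\<in>?M. Const (lookup q m) * subst_monom e m)"
    by (simp add: lookup_add sum.distrib distrib_right flip: Const_add)
  finally show ?thesis
    by (simp add: poly_subst_superset[of ?M])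
qed

lemma poly_subst_sum: "poly_subst e (sum f I) = (\<Sum>i\<in>I. poly_subst e (f i))"
  by (induction I rule: infinite_finite_induct) (simp_all add: poly_subst_add)

lemma poly_subst_mult: "poly_subst e (p * q) = poly_subst e p * poly_subst e q"
proof -
  have "poly_subst e (p * q) =
      (\<Sum>m\<in>keys p. \<Sum>n\<in>keys q. (Const (lookup p m) * subst_monom e m) * (Const (lookup q n) * subst_monom e n))"
    by (subst mult_eq_sum_single)
      (simp add: poly_subst_sum poly_subst_single subst_monom_add mult_ac flip: Const_mult)
  then show ?thesis
    by (simp add: sum_product poly_subst_superset[of "keys p" p] poly_subst_superset[of "keys q" q])
qed

lemma poly_subst_diff: "poly_subst e (p - q) = poly_subst e p - poly_subst e q"
  using poly_subst_add[of e "p - q" q] by simp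

lemma poly_subst_power: "poly_subst e (p ^ n) = poly_subst e p ^ n"
  by (induction n) (simp_all add: poly_subst_mult)

lemma poly_subst_prod: "poly_subst e (prod f I) = (\<Prod>i\<in>I. poly_subst e (f i))"
  by (induction I rule: infinite_finite_induct) (simp_all add: poly_subst_mult)

lemma poly_subst_poly_subst: "poly_subst e (poly_subst e' p) = poly_subst (\<lambda>v. poly_subst e (e' v)) p"
  unfolding poly_subst_def[of e' p] poly_subst_def[of "\<lambda>v. poly_subst e (e' v)" p]
  by (simp add: poly_subst_sum poly_subst_mult poly_subst_prod poly_subst_power)

lemma poly_subst_cong:
  assumes "\<And>m v. m \<in> keys p \<Longrightarrow> v \<in> keys m \<Longrightarrow> e v = e' v"
  shows "poly_subst e p = poly_subst e' p"
  unfolding poly_subst_def using assms by (intro sum.cong arg_cong2[where f = "(*)"] refl prod.cong) auto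

lemma subst_monom_monomials:
  assumes "\<And>v. v \<in> keys m \<Longrightarrow> e v = single (single (f v) 1) 1"
  shows "subst_monom e m = single (\<Sum>v\<in>keys m. single (f v) (lookup m v)) (1 :: 'k::comm_ring_1)"
proof -
  have "single (single w 1) (1 :: 'k) ^ n = single (single w n) 1" for w :: 'b and n :: nat
    by (induction n) (simp_all add: mult_single flip: single_add)
  then have "subst_monom e m = (\<Prod>v\<in>keys m. single (single (f v) (lookup m v)) 1)"
    unfolding subst_monom_def by (intro prod.cong) (simp_all add: assms)
  also have "\<dots> = single (\<Sum>v\<in>keys m. single (f v) (lookup m v)) 1"
    by (induction rule: finite_induct[OF finite_keys[of m]]) (simp_all add: mult_single)
  finally show ?thesis .
qed

lemma subst_monom_Var: "subst_monom (\<lambda>(s, j). Var s j) m = single m (1 :: 'k::comm_ring_1)"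
  using subst_monom_monomials[of m "\<lambda>(s, j). Var s j :: 'k mpoly" "\<lambda>v. v"]
  by (auto simp: Var_def sum_single)

lemma poly_subst_Var_id: "poly_subst (\<lambda>(s, j). Var s j) p = p"
  using sum_single[of p]
  by (simp add: poly_subst_superset[of "keys p" p] subst_monom_Var Const_mult_single)

section \<open>Multidegrees and homogeneous components\<close>

definition mdeg :: "(nat \<times> nat \<Rightarrow>\<^sub>0 nat) \<Rightarrow> nat \<Rightarrow>\<^sub>0 nat" where
  "mdeg m = (\<Sum>v\<in>keys m. single (fst v) (lookup m v))"

lemma mdeg_superset:
  assumes "finite V" "keys m \<subseteq> V"
  shows "mdeg m = (\<Sum>v\<in>V. single (fst v) (lookup m v))"
  unfolding mdeg_def
  using assms by (intro sum.mono_neutral_left) (auto simp: in_keys_iff)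

lemma mdeg_0 [simp]: "mdeg 0 = 0"
  by (simp add: mdeg_def)

lemma mdeg_add: "mdeg (m + n) = mdeg m + mdeg n"
proof -
  let ?V = "keys m \<union> keys n"
  have "mdeg (m + n) = (\<Sum>v\<in>?V. single (fst v) (lookup (m + n) v))"
    by (rule mdeg_superset) (auto dest: subsetD[OF keys_add])
  then show ?thesis
    by (simp add: lookup_add single_add sum.distrib mdeg_superset[of ?V])
qed

lemma finite_row: "finite {j. (s, j) \<in> keys m}"
  using finite_vimageI[OF finite_keys[of m], of "Pair s"] by (simp add: inj_on_def vimage_def)

lemma lookup_mdeg: "lookup (mdeg m) s = (\<Sum>j\<in>{j. (s, j) \<in> keys m}. lookup m (s, j))"
proof -
  have "lookup (mdeg m) s = (\<Sum>v\<in>keys m. if fst v = s then lookup m v else 0)"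
    by (simp add: mdeg_def lookup_sum lookup_single when_def)
  also have "\<dots> = (\<Sum>v\<in>{v\<in>keys m. fst v = s}. lookup m v)"
    by (simp add: sum.inter_filter)
  also have "{v\<in>keys m. fst v = s} = Pair s ` {j. (s, j) \<in> keys m}"
    by force
  finally show ?thesis
    by (simp add: sum.reindex inj_on_def)
qed

lemma homogeneous_iff: "homogeneous J p \<longleftrightarrow> (\<forall>m\<in>keys p. mdeg m = J)"
  unfolding homogeneous_def by (simp add: poly_mapping_eq_iff fun_eq_iff lookup_mdeg)

lemma mdeg_eq_0_iff: "mdeg m = 0 \<longleftrightarrow> m = 0"
proof
  assume *: "mdeg m = 0"
  have "lookup m (s, j) = 0" for s j
  proof (rule ccontr)
    assume "lookup m (s, j) \<noteq> 0"
    then have "(s, j) \<in> keys m" by (simp add: in_keys_iff)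
    then have "lookup (mdeg m) s > 0"
      unfolding lookup_mdeg using \<open>lookup m (s, j) \<noteq> 0\<close> finite_row by (intro sum_pos2[of _ j]) auto
    then show False using * by simp
  qed
  then show "m = 0"
    by (auto intro: poly_mapping_eqI)
qed simp

lemma homogeneous_0 [simp]: "homogeneous J 0"
  by (simp add: homogeneous_iff)

lemma homogeneous_Const [simp]: "homogeneous 0 (Const c)"
  by (simp add: homogeneous_iff Const_def)

lemma homogeneous_add: "homogeneous J p \<Longrightarrow> homogeneous J q \<Longrightarrow> homogeneous J (p + q)"
  unfolding homogeneous_iff using keys_add[of p q] by blast

lemma homogeneous_sum: "(\<And>i. i \<in> I \<Longrightarrow> homogeneous J (f i)) \<Longrightarrow> homogeneous J (sum f I)"
  by (induction I rule: infinite_finite_induct) (simp_all add: homogeneous_add)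

lemma homogeneous_mult: "homogeneous I p \<Longrightarrow> homogeneous J q \<Longrightarrow> homogeneous (I + J) (p * q)"
  unfolding homogeneous_iff by (fastforce dest!: subsetD[OF keys_mult] simp: mdeg_add)

lemma homogeneous_Const_mult: "homogeneous J p \<Longrightarrow> homogeneous J (Const c * p)"
  unfolding homogeneous_iff using keys_Const_mult[of c p] by blast

lemma homogeneous_Var: "homogeneous (single s 1) (Var s j)"
  by (simp add: homogeneous_iff Var_def mdeg_def)

definition component :: "(nat \<Rightarrow>\<^sub>0 nat) \<Rightarrow> 'k::comm_ring_1 mpoly \<Rightarrow> 'k mpoly" where
  "component J p = (\<Sum>m\<in>{m\<in>keys p. mdeg m = J}. single m (lookup p m))"

lemma lookup_component: "lookup (component J p) m = (if mdeg m = J then lookup p m else 0)"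
  by (auto simp: component_def lookup_sum lookup_single when_def in_keys_iff)

lemma keys_component: "keys (component J p) = {m\<in>keys p. mdeg m = J}"
  by (auto simp: in_keys_iff lookup_component split: if_splits)

lemma component_0 [simp]: "component J 0 = 0"
  by (simp add: component_def)

lemma component_add: "component J (p + q) = component J p + component J q"
  by (intro poly_mapping_eqI) (simp add: lookup_component lookup_add)

lemma component_diff: "component J (p - q) = component J p - component J q"
  by (intro poly_mapping_eqI) (simp add: lookup_component lookup_minus)

lemma component_sum: "component J (sum f I) = (\<Sum>i\<in>I. component J (f i))"
  by (induction I rule: infinite_finite_induct) (simp_all add: component_add)

lemma homogeneous_component [simp]: "homogeneous J (component J p)"
  by (simp add: homogeneous_iff keys_component)

lemma component_homogeneous: "homogeneous J p \<Longrightarrow> component I p = (if I = J then p else 0)"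
  by (intro poly_mapping_eqI) (auto simp: lookup_component homogeneous_iff in_keys_iff)

lemma sum_components:
  assumes "finite D" "mdeg ` keys p \<subseteq> D"
  shows "(\<Sum>J\<in>D. component J p) = p"
proof (rule poly_mapping_eqI)
  fix m
  show "lookup (\<Sum>J\<in>D. component J p) m = lookup p m"
    using assms by (cases "m \<in> keys p") (auto simp: lookup_sum lookup_component in_keys_iff)
qed

lemma homogeneous_subst_monom:
  assumes "\<And>v. v \<in> keys m \<Longrightarrow> homogeneous (single (fst v) 1) (e v)"
  shows "homogeneous (mdeg m) (subst_monom e m)"
proof -
  have pow: "homogeneous (single (fst v) n) (e v ^ n)" if "v \<in> keys m" for v n
  proof (induction n)
    case (Suc n)
    show ?case
      using homogeneous_mult[OF assms[OF that] Suc] by (simp flip: single_add)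
  qed (simp flip: Const_one)
  have "homogeneous (\<Sum>v\<in>V. single (fst v) (lookup m v)) (\<Prod>v\<in>V. e v ^ lookup m v)"
    if "finite V" "V \<subseteq> keys m" for V
    using that by (induction V) (simp_all add: homogeneous_mult pow flip: Const_one)
  then show ?thesis
    by (simp add: mdeg_def subst_monom_def)
qed

lemma homogeneous_poly_subst:
  assumes "\<And>v. homogeneous (single (fst v) 1) (e v)" "homogeneous J p"
  shows "homogeneous J (poly_subst e p)"
  unfolding poly_subst_superset[OF finite_keys subset_refl]
  using assms homogeneous_subst_monom[of _ e]
  by (intro homogeneous_sum homogeneous_Const_mult) (auto simp: homogeneous_iff)

text \<open>
  A substitution that respects degrees maps the decomposition of \<open>p\<close> into
  components to a decomposition of the image, and components are unique.
\<close>

lemma component_poly_subst: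
  assumes "\<And>v. homogeneous (single (fst v) 1) (e v)"
  shows "component J (poly_subst e p) = poly_subst e (component J p)"
proof -
  let ?D = "insert J (mdeg ` keys p)"
  have "poly_subst e p = (\<Sum>I\<in>?D. poly_subst e (component I p))"
    by (subst poly_subst_sum[symmetric], subst sum_components) auto
  then have "component J (poly_subst e p) = (\<Sum>I\<in>?D. if J = I then poly_subst e (component I p) else 0)"
    by (simp only: component_sum component_homogeneous[OF homogeneous_poly_subst[OF assms homogeneous_component]])
  then show ?thesis by simp
qed

section \<open>Polynomial algebras and pullback along morphisms\<close>

lemma keys_uminus_poly: "keys (- p) = keys (p :: 'a \<Rightarrow>\<^sub>0 'b::ab_group_add)"
  by (auto simp: in_keys_iff)

lemma poly_alg_simps [simp]:
  "monoid.mult (poly_alg r S) = (*)" "one (poly_alg r S) = 1" "ring.zero (poly_alg r S) = 0"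
  "add (poly_alg r S) = (+)" "module.smult (poly_alg r S) = (\<lambda>c p. Const c * p)"
  by (simp_all add: poly_alg_def)

lemma poly_alg_iff: "p \<in> carrier (poly_alg r S) \<longleftrightarrow> (\<forall>m\<in>keys p. keys m \<subseteq> {1..r} \<times> S)"
  by (simp add: poly_alg_def)

lemma poly_alg_closed [simp, intro]:
  "0 \<in> carrier (poly_alg r S)" "1 \<in> carrier (poly_alg r S)" "Const c \<in> carrier (poly_alg r S)"
  "p \<in> carrier (poly_alg r S) \<Longrightarrow> q \<in> carrier (poly_alg r S) \<Longrightarrow> p + q \<in> carrier (poly_alg r S)"
  "p \<in> carrier (poly_alg r S) \<Longrightarrow> q \<in> carrier (poly_alg r S) \<Longrightarrow> p * q \<in> carrier (poly_alg r S)"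
  "p \<in> carrier (poly_alg r S) \<Longrightarrow> - p \<in> carrier (poly_alg r S)"
  "p \<in> carrier (poly_alg r S) \<Longrightarrow> component J p \<in> carrier (poly_alg r S)"
proof -
  show "p \<in> carrier (poly_alg r S) \<Longrightarrow> q \<in> carrier (poly_alg r S) \<Longrightarrow> p + q \<in> carrier (poly_alg r S)"
    unfolding poly_alg_iff using keys_add[of p q] by blast
  assume *: "p \<in> carrier (poly_alg r S)" "q \<in> carrier (poly_alg r S)"
  show "p * q \<in> carrier (poly_alg r S)"
    unfolding poly_alg_iff
  proof
    fix m assume "m \<in> keys (p * q)"
    then obtain a b where "m = a + b" "a \<in> keys p" "b \<in> keys q"
      using keys_mult[of p q] by blast
    then show "keys m \<subseteq> {1..r} \<times> S"
      using * keys_add[of a b] unfolding poly_alg_iff by blast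
  qed
qed (auto simp: poly_alg_iff keys_uminus_poly keys_component Const_def)

lemma poly_alg_diff [simp, intro]:
  "p \<in> carrier (poly_alg r S) \<Longrightarrow> q \<in> carrier (poly_alg r S) \<Longrightarrow> p - q \<in> carrier (poly_alg r S)"
  using poly_alg_closed(4)[of p r S "- q"] by auto

lemma poly_alg_sum [intro]:
  "(\<And>i. i \<in> I \<Longrightarrow> f i \<in> carrier (poly_alg r S)) \<Longrightarrow> sum f I \<in> carrier (poly_alg r S)"
  by (induction I rule: infinite_finite_induct) auto

lemma poly_alg_prod [intro]:
  "(\<And>i. i \<in> I \<Longrightarrow> f i \<in> carrier (poly_alg r S)) \<Longrightarrow> prod f I \<in> carrier (poly_alg r S)"
  by (induction I rule: infinite_finite_induct) auto

lemma poly_alg_power [intro]: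
  "p \<in> carrier (poly_alg r S) \<Longrightarrow> p ^ n \<in> carrier (poly_alg r S)"
  by (induction n) auto

lemma poly_subst_closed:
  assumes "\<And>v. v \<in> {1..r} \<times> S \<Longrightarrow> e v \<in> carrier (poly_alg r R)" "p \<in> carrier (poly_alg r S)"
  shows "poly_subst e p \<in> carrier (poly_alg r R)"
  unfolding poly_subst_def
  using assms by (intro poly_alg_sum poly_alg_closed(5) poly_alg_prod poly_alg_power poly_alg_closed(3))
    (auto simp: poly_alg_iff[of p])

lemma cring_poly_alg: "cring (poly_alg r S)"
proof (rule cringI)
  show "abelian_group (poly_alg r S)"
  proof (rule abelian_groupI)
    fix x assume "x \<in> carrier (poly_alg r S)"
    then show "\<exists>y\<in>carrier (poly_alg r S). y \<oplus>\<^bsub>poly_alg r S\<^esub> x = \<zero>\<^bsub>poly_alg r S\<^esub>"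
      by (intro bexI[of _ "- x"]) auto
  qed (auto simp: add_ac)
  show "comm_monoid (poly_alg r S)"
    by (rule comm_monoidI) (auto simp: mult_ac)
qed (auto simp: distrib_right)

lemma mdeg_in_multidegrees:
  assumes "keys m \<subseteq> {1..r} \<times> S"
  shows "mdeg m \<in> multidegrees r"
proof -
  have "lookup (mdeg m) s = 0" if "s \<notin> {1..r}" for s
  proof -
    have "{j. (s, j) \<in> keys m} = {}" using assms that by blast
    then show ?thesis by (simp add: lookup_mdeg)
  qed
  then show ?thesis
    unfolding multidegrees_def by (force simp: in_keys_iff)
qed

definition pullback_var :: "'k::field \<Rightarrow> nat set \<Rightarrow> int FI_mor \<Rightarrow> nat \<times> nat \<Rightarrow> 'k mpoly" where
  "pullback_var \<zeta> R \<phi> = (\<lambda>(s, i). \<Sum>j\<in>R. Const (FI_matrix \<zeta> \<phi> i j) * Var s j)"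

lemma pullback_eq: "pullback \<zeta> R \<phi> = poly_subst (pullback_var \<zeta> R \<phi>)"
  by (simp add: pullback_def pullback_var_def)

lemma homogeneous_pullback_var: "homogeneous (single (fst v) 1) (pullback_var \<zeta> R \<phi> v)"
  by (cases v)
     (auto simp: pullback_var_def simp del: One_nat_def
       intro!: homogeneous_sum homogeneous_Const_mult homogeneous_Var)

lemma Var_closed: "s \<in> {1..r} \<Longrightarrow> j \<in> S \<Longrightarrow> Var s j \<in> carrier (poly_alg r S)"
  by (auto simp: Var_def poly_alg_iff)

lemma pullback_closed:
  "p \<in> carrier (poly_alg r S) \<Longrightarrow> pullback \<zeta> R \<phi> p \<in> carrier (poly_alg r R)"
  unfolding pullback_eq
  by (rule poly_subst_closed[of _ S]) (auto simp: pullback_var_def intro!: poly_alg_sum poly_alg_closed Var_closed)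

lemma pullback_component: "component J (pullback \<zeta> R \<phi> p) = pullback \<zeta> R \<phi> (component J p)"
  unfolding pullback_eq by (rule component_poly_subst) (rule homogeneous_pullback_var)

lemma homogeneous_pullback: "homogeneous J p \<Longrightarrow> homogeneous J (pullback \<zeta> R \<phi> p)"
  unfolding pullback_eq by (rule homogeneous_poly_subst) (rule homogeneous_pullback_var)

lemma pullback_hom:
  "pullback \<zeta> R \<phi> (p + q) = pullback \<zeta> R \<phi> p + pullback \<zeta> R \<phi> q"
  "pullback \<zeta> R \<phi> (p * q) = pullback \<zeta> R \<phi> p * pullback \<zeta> R \<phi> q"
  "pullback \<zeta> R \<phi> (p - q) = pullback \<zeta> R \<phi> p - pullback \<zeta> R \<phi> q"
  "pullback \<zeta> R \<phi> (Const c) = Const c" "pullback \<zeta> R \<phi> 0 = 0" "pullback \<zeta> R \<phi> 1 = 1"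
  by (simp_all add: pullback_eq poly_subst_add poly_subst_mult poly_subst_diff)

lemma pullback_var_eq:
  assumes "finite R" "(a, g) \<in> FI_hom (integer_mod_group d) R S" "j \<in> R"
  shows "pullback_var \<zeta> R (a, g) (s, a j) = Const (\<zeta> ^ nat (g j)) * Var s j"
  using pullback_Var_image[OF assms, of \<zeta> s] by (simp add: pullback_eq poly_subst_Var)

lemma pullback_var_not_image: "l \<notin> a ` R \<Longrightarrow> pullback_var \<zeta> R (a, g) (s, l) = 0"
  using pullback_Var_not_image[of l a R \<zeta> g s] by (simp add: pullback_eq poly_subst_Var)

lemma pullback_id:
  assumes "finite S" "p \<in> carrier (poly_alg r S)"
  shows "pullback \<zeta> S (FI_id (integer_mod_group d) S) p = p"
proof -
  have "pullback_var \<zeta> S (FI_id (integer_mod_group d) S) v = (\<lambda>(s, j). Var s j) v"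
    if "m \<in> keys p" "v \<in> keys m" for m v
  proof -
    obtain s i where v: "v = (s, i)" "i \<in> S"
      using assms(2) \<open>m \<in> keys p\<close> \<open>v \<in> keys m\<close> unfolding poly_alg_iff by blast
    have "pullback_var \<zeta> S (FI_id (integer_mod_group d) S) v = (\<Sum>j\<in>S. if i = j then Var s j else 0)"
      unfolding pullback_var_def FI_matrix_def FI_id_def v prod.case
      by (intro sum.cong) (auto simp: Const_zero Const_one)
    then show ?thesis using assms(1) v by simp
  qed
  then show ?thesis
    using poly_subst_cong[of p "pullback_var \<zeta> S (FI_id (integer_mod_group d) S)" "\<lambda>(s, j). Var s j"]
    by (simp add: pullback_eq poly_subst_Var_id)
qed

text \<open>
  Labels are represented by integers between \<open>0\<close> and \<open>d - 1\<close> and are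
  added modulo \<open>d\<close>; since \<open>\<zeta> ^ d = 1\<close>, powers of
  \<open>\<zeta>\<close> do not see the reduction.
\<close>

lemma power_nat_mod:
  assumes "\<zeta> ^ d = (1 :: 'k::field)" "x \<ge> 0" "y \<ge> 0"
  shows "\<zeta> ^ nat ((x + y) mod int d) = \<zeta> ^ nat x * \<zeta> ^ nat y"
proof -
  have "\<zeta> ^ (n mod d) = \<zeta> ^ n" for n
  proof -
    have "\<zeta> ^ n = \<zeta> ^ (d * (n div d) + n mod d)" by simp
    also have "\<dots> = \<zeta> ^ (n mod d)" unfolding power_add power_mult assms(1) by simp
    finally show ?thesis by simp
  qed
  moreover have "nat ((x + y) mod int d) = (nat x + nat y) mod d"
    using assms(2,3) by (simp add: nat_mod_distrib nat_add_distrib)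
  ultimately show ?thesis
    by (simp add: power_add)
qed

text \<open>
  Both sides are substitutions, so it is enough to compare them on variables, where the claim
  says that the matrix of a composite is the product of the matrices.
\<close>

lemma pullback_comp:
  assumes "d \<ge> 1" "\<zeta> ^ d = 1" "finite Q" "finite R"
    and \<phi>: "\<phi> \<in> FI_hom (integer_mod_group d) Q R" and \<psi>: "\<psi> \<in> FI_hom (integer_mod_group d) R S"
  shows "pullback \<zeta> Q (FI_comp (integer_mod_group d) Q \<psi> \<phi>) p = pullback \<zeta> Q \<phi> (pullback \<zeta> R \<psi> p)"
proof -
  obtain a g b h where eq: "\<phi> = (a, g)" "\<psi> = (b, h)" by (metis surj_pair)
  let ?c = "FI_comp (integer_mod_group d) Q \<psi> \<phi>"
  have aR: "a j \<in> R" and g: "g j \<ge> 0" if "j \<in> Q" for j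
    using \<phi> that assms(1) by (auto simp: eq FI_hom_def carrier_integer_mod_group dest!: PiE_mem)
  have h: "h j \<ge> 0" if "j \<in> R" for j
    using \<psi> that assms(1) by (auto simp: eq FI_hom_def carrier_integer_mod_group dest!: PiE_mem)
  have "pullback_var \<zeta> Q ?c (s, i) = poly_subst (pullback_var \<zeta> Q \<phi>) (pullback_var \<zeta> R \<psi> (s, i))" for s i
  proof -
    have entry: "FI_matrix \<zeta> ?c i j = (\<Sum>l\<in>R. FI_matrix \<zeta> \<psi> i l * FI_matrix \<zeta> \<phi> l j)" if "j \<in> Q" for j
    proof -
      have "(\<Sum>l\<in>R. FI_matrix \<zeta> \<psi> i l * FI_matrix \<zeta> \<phi> l j) =
          (\<Sum>l\<in>R. if l = a j then FI_matrix \<zeta> \<psi> i (a j) * \<zeta> ^ nat (g j) else 0)"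
        by (intro sum.cong) (auto simp: FI_matrix_def eq)
      also have "\<dots> = FI_matrix \<zeta> \<psi> i (a j) * \<zeta> ^ nat (g j)"
        using aR[OF that] assms(4) by simp
      also have "\<dots> = FI_matrix \<zeta> ?c i j"
        using that power_nat_mod[OF assms(2) g[OF that] h[OF aR[OF that]]]
        by (simp add: FI_matrix_def FI_comp_def eq compose_def)
      finally show ?thesis by simp
    qed
    have "poly_subst (pullback_var \<zeta> Q \<phi>) (pullback_var \<zeta> R \<psi> (s, i)) =
        (\<Sum>l\<in>R. \<Sum>j\<in>Q. Const (FI_matrix \<zeta> \<psi> i l * FI_matrix \<zeta> \<phi> l j) * Var s j)"
      unfolding pullback_var_def[of \<zeta> R] prod.case poly_subst_sum poly_subst_mult poly_subst_Const poly_subst_Var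
      by (simp add: pullback_var_def sum_distrib_left mult_ac flip: Const_mult)
    also have "\<dots> = (\<Sum>j\<in>Q. Const (\<Sum>l\<in>R. FI_matrix \<zeta> \<psi> i l * FI_matrix \<zeta> \<phi> l j) * Var s j)"
      by (subst sum.swap) (simp add: Const_sum sum_distrib_right)
    also have "\<dots> = (\<Sum>j\<in>Q. Const (FI_matrix \<zeta> ?c i j) * Var s j)"
      by (intro sum.cong) (simp_all add: entry)
    finally show ?thesis
      by (simp add: pullback_var_def)
  qed
  then have "pullback_var \<zeta> Q ?c = (\<lambda>v. poly_subst (pullback_var \<zeta> Q \<phi>) (pullback_var \<zeta> R \<psi> v))"
    by (auto simp: fun_eq_iff)
  then show ?thesis
    by (simp add: pullback_eq poly_subst_poly_subst)
qed

lemma wreath_subset_FI_hom: "carrier (wreath G S) \<subseteq> FI_hom G S S"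
  by (auto simp: wreath_def FI_hom_def Bij_def bij_betw_def extensional_def PiE_def)

text \<open>
  The extension \<open>w'\<close> acts on the image of the morphism by transport of structure
  and trivially off the image.
\<close>

lemma wreath_extend:
  assumes "group G" and \<phi>: "\<phi> \<in> FI_hom G R S" and w: "w \<in> carrier (wreath G R)"
  shows "\<exists>w'\<in>carrier (wreath G S). FI_comp G R w' \<phi> = FI_comp G R \<phi> w"
proof -
  interpret group G by fact
  obtain a g b h where eq: "\<phi> = (a, g)" "w = (b, h)" by (metis surj_pair)
  have a: "a \<in> R \<rightarrow>\<^sub>E S" "inj_on a R" and g: "g \<in> R \<rightarrow>\<^sub>E carrier G"
    using \<phi> by (auto simp: eq FI_hom_def)
  have b: "bij_betw b R R" "b \<in> extensional R" and h: "h \<in> R \<rightarrow>\<^sub>E carrier G"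
    using w by (auto simp: eq wreath_def Bij_def)
  have bR: "b i \<in> R" if "i \<in> R" for i
    using b(1) that by (auto simp: bij_betw_def)
  have gh: "g i \<in> carrier G" "h i \<in> carrier G" "a i \<in> S" if "i \<in> R" for i
    using g h a(1) that by auto
  define a' where "a' = the_inv_into R a"
  have a': "a' (a i) = i" if "i \<in> R" for i
    using a(2) that by (simp add: a'_def the_inv_into_f_f)
  define b' where "b' = (\<lambda>i\<in>S. if i \<in> a ` R then a (b (a' i)) else i)"
  \<comment> \<open>On the image, the label of \<open>a i\<close> solves \<open>g i \<otimes> h' (a i) = h i \<otimes> g (b i)\<close>, the equality of labels of the two composites.\<close>
  define h' where "h' = (\<lambda>i\<in>S. if i \<in> a ` R then inv\<^bsub>G\<^esub> g (a' i) \<otimes>\<^bsub>G\<^esub> (h (a' i) \<otimes>\<^bsub>G\<^esub> g (b (a' i))) else \<one>\<^bsub>G\<^esub>)"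
  have b'S: "b' i \<in> S" if "i \<in> S" for i
    using that gh bR a' by (auto simp: b'_def)
  have "bij_betw b' S S"
  proof -
    have "bij_betw b' (a ` R) (a ` R)"
    proof -
      have 1: "bij_betw a R (a ` R)"
        using a(2) by (simp add: bij_betw_def)
      have 2: "bij_betw a' (a ` R) R"
        unfolding a'_def by (rule bij_betw_the_inv_into[OF 1])
      have "bij_betw (a \<circ> (b \<circ> a')) (a ` R) (a ` R)"
        by (rule bij_betw_trans[OF bij_betw_trans[OF 2 b(1)] 1])
      moreover have "b' i = (a \<circ> (b \<circ> a')) i" if "i \<in> a ` R" for i
        using that gh(3) by (auto simp: b'_def)
      ultimately show ?thesis
        using bij_betw_cong[of "a ` R" b' "a \<circ> (b \<circ> a')" "a ` R"] by blast
    qed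
    moreover have "bij_betw b' (S - a ` R) (S - a ` R)"
      by (rule bij_betw_cong[THEN iffD1, OF _ bij_betw_id]) (auto simp: b'_def)
    moreover have "a ` R \<union> (S - a ` R) = S" using gh(3) by blast
    ultimately show ?thesis
      using bij_betw_combine[of b' "a ` R" "a ` R" "S - a ` R" "S - a ` R"] by auto
  qed
  moreover have "h' \<in> S \<rightarrow>\<^sub>E carrier G"
    using gh bR a' by (auto simp: h'_def)
  ultimately have "(b', h') \<in> carrier (wreath G S)"
    by (auto simp: wreath_def Bij_def b'_def)
  moreover have "FI_comp G R (b', h') \<phi> = FI_comp G R \<phi> w"
  proof -
    have "b' (a i) = a (b i)" "g i \<otimes>\<^bsub>G\<^esub> h' (a i) = h i \<otimes>\<^bsub>G\<^esub> g (b i)" if "i \<in> R" for i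
      using that gh bR a' by (auto simp: b'_def h'_def m_assoc[symmetric])
    then show ?thesis
      by (auto simp: eq FI_comp_def compose_def restrict_def)
  qed
  ultimately show ?thesis by blast
qed

text \<open>
  If \<open>w'\<close> extends \<open>w\<close> along \<open>\<phi>\<close>, then pulling back
  along \<open>\<phi>\<close> and then \<open>w\<close> is the same as pulling back along
  \<open>w'\<close>, which fixes an invariant, and then \<open>\<phi>\<close>.
\<close>

lemma invariants_pullback:
  assumes "d \<ge> 1" "\<zeta> ^ d = 1" "finite R" "finite S"
    and \<phi>: "\<phi> \<in> FI_hom (integer_mod_group d) R S" and p: "p \<in> invariants \<zeta> d r S"
  shows "pullback \<zeta> R \<phi> p \<in> invariants \<zeta> d r R"
  unfolding invariants_def
proof (intro CollectI conjI ballI)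
  show "pullback \<zeta> R \<phi> p \<in> carrier (poly_alg r R)"
    using p by (auto simp: invariants_def intro: pullback_closed)
  fix w assume w: "w \<in> carrier (wreath (integer_mod_group d) R)"
  obtain w' where w': "w' \<in> carrier (wreath (integer_mod_group d) S)"
    "FI_comp (integer_mod_group d) R w' \<phi> = FI_comp (integer_mod_group d) R \<phi> w"
    using wreath_extend[OF group_integer_mod_group \<phi> w] by blast
  note hom = subsetD[OF wreath_subset_FI_hom]
  have "pullback \<zeta> R w (pullback \<zeta> R \<phi> p) = pullback \<zeta> R (FI_comp (integer_mod_group d) R \<phi> w) p"
    using pullback_comp[OF assms(1,2,3,3) hom[OF w] \<phi>] by simp
  also have "\<dots> = pullback \<zeta> R \<phi> (pullback \<zeta> S w' p)"
    using pullback_comp[OF assms(1,2,3,4) \<phi> hom[OF w'(1)]] w'(2) by simp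
  also have "pullback \<zeta> S w' p = p"
    using p w'(1) by (simp add: invariants_def)
  finally show "pullback \<zeta> R w (pullback \<zeta> R \<phi> p) = pullback \<zeta> R \<phi> p" .
qed

lemma invariants_component: "p \<in> invariants \<zeta> d r S \<Longrightarrow> component J p \<in> invariants \<zeta> d r S"
  by (auto simp: invariants_def simp flip: pullback_component)

lemma lookup_0_component: "lookup (component 0 p) 0 = lookup p 0"
  by (simp add: lookup_component)

lemma component_0_eq_0_iff: "component 0 p = 0 \<longleftrightarrow> lookup p 0 = 0"
proof
  assume "component 0 p = 0"
  then show "lookup p 0 = 0" using lookup_0_component[of p] by simp
next
  assume "lookup p 0 = 0"
  then have "lookup (component 0 p) m = lookup 0 m" for m
    unfolding lookup_component mdeg_eq_0_iff by simp
  then show "component 0 p = 0" by (rule poly_mapping_eqI)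
qed

text \<open>
  The constant term is the component of degree \<open>0\<close>, and pullback commutes with
  taking components.
\<close>

lemma lookup_0_pullback:
  assumes "lookup p 0 = 0"
  shows "lookup (pullback \<zeta> R \<phi> p) 0 = 0"
  using assms unfolding component_0_eq_0_iff[symmetric] pullback_component by (simp add: pullback_hom)

section \<open>The coinvariant ideal\<close>

lemma ring_poly_alg: "ring (poly_alg r S)"
  using cring_poly_alg by (rule cring.axioms)

lemma poly_alg_a_inv [simp]:
  assumes "p \<in> carrier (poly_alg r S)"
  shows "\<ominus>\<^bsub>poly_alg r S\<^esub> p = - p"
  by (rule abelian_group.minus_equality[OF ring.is_abelian_group[OF ring_poly_alg]]) (use assms in auto)

lemma invariants_subset: "invariants \<zeta> d r S \<subseteq> carrier (poly_alg r S)"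
  by (auto simp: invariants_def)

lemma ideal_coinv_ideal: "ideal (coinv_ideal \<zeta> d r S) (poly_alg r S)"
  unfolding coinv_ideal_def
  by (rule ring.genideal_ideal[OF ring_poly_alg]) (use invariants_subset in blast)

lemma coinv_ideal_closed:
  "p \<in> coinv_ideal \<zeta> d r S \<Longrightarrow> p \<in> carrier (poly_alg r S)"
  "0 \<in> coinv_ideal \<zeta> d r S"
  "p \<in> coinv_ideal \<zeta> d r S \<Longrightarrow> q \<in> coinv_ideal \<zeta> d r S \<Longrightarrow> p + q \<in> coinv_ideal \<zeta> d r S"
  "x \<in> carrier (poly_alg r S) \<Longrightarrow> p \<in> coinv_ideal \<zeta> d r S \<Longrightarrow> x * p \<in> coinv_ideal \<zeta> d r S"
  "p \<in> coinv_ideal \<zeta> d r S \<Longrightarrow> - p \<in> coinv_ideal \<zeta> d r S"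
  "p \<in> coinv_ideal \<zeta> d r S \<Longrightarrow> q \<in> coinv_ideal \<zeta> d r S \<Longrightarrow> p - q \<in> coinv_ideal \<zeta> d r S"
proof -
  interpret ideal "coinv_ideal \<zeta> d r S" "poly_alg r S"
    by (rule ideal_coinv_ideal)
  show sub: "p \<in> coinv_ideal \<zeta> d r S \<Longrightarrow> p \<in> carrier (poly_alg r S)" for p
    by (rule a_Hcarr)
  show "0 \<in> coinv_ideal \<zeta> d r S"
    using additive_subgroup.zero_closed[OF is_additive_subgroup] by simp
  show add: "p \<in> coinv_ideal \<zeta> d r S \<Longrightarrow> q \<in> coinv_ideal \<zeta> d r S \<Longrightarrow> p + q \<in> coinv_ideal \<zeta> d r S" for p q
    using additive_subgroup.a_closed[OF is_additive_subgroup, of p q] by simp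
  show "x \<in> carrier (poly_alg r S) \<Longrightarrow> p \<in> coinv_ideal \<zeta> d r S \<Longrightarrow> x * p \<in> coinv_ideal \<zeta> d r S"
    using I_l_closed[of p x] by simp
  show neg: "p \<in> coinv_ideal \<zeta> d r S \<Longrightarrow> - p \<in> coinv_ideal \<zeta> d r S" for p
    using additive_subgroup.a_inv_closed[OF is_additive_subgroup, of p] sub[of p] by simp
  show "p \<in> coinv_ideal \<zeta> d r S \<Longrightarrow> q \<in> coinv_ideal \<zeta> d r S \<Longrightarrow> p - q \<in> coinv_ideal \<zeta> d r S"
    using add[OF _ neg[of q]] by simp
qed

lemma invariant_in_coinv_ideal:
  "p \<in> invariants \<zeta> d r S \<Longrightarrow> lookup p 0 = 0 \<Longrightarrow> p \<in> coinv_ideal \<zeta> d r S"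
  unfolding coinv_ideal_def
  by (rule subsetD[OF ring.genideal_self[OF ring_poly_alg]]) (use invariants_subset in blast)+

lemma coinv_ideal_sum:
  "(\<And>i. i \<in> A \<Longrightarrow> f i \<in> coinv_ideal \<zeta> d r S) \<Longrightarrow> sum f A \<in> coinv_ideal \<zeta> d r S"
  by (induction A rule: infinite_finite_induct) (auto intro: coinv_ideal_closed)

lemma coinv_ideal_least:
  fixes \<zeta> :: "'k::field"
  assumes N: "N \<subseteq> carrier (poly_alg r S)" "0 \<in> N" "\<And>p q. p \<in> N \<Longrightarrow> q \<in> N \<Longrightarrow> p + q \<in> N"
    "\<And>x p. x \<in> carrier (poly_alg r S) \<Longrightarrow> p \<in> N \<Longrightarrow> x * p \<in> N"
    and gens: "\<And>p. p \<in> invariants \<zeta> d r S \<Longrightarrow> lookup p 0 = 0 \<Longrightarrow> p \<in> N"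
  shows "coinv_ideal \<zeta> d r S \<subseteq> N"
  unfolding coinv_ideal_def
proof (rule ring.genideal_minimal[OF ring_poly_alg])
  show "ideal N (poly_alg r S)"
  proof (rule idealI[OF ring_poly_alg])
    show "subgroup N (add_monoid (poly_alg r S))"
    proof (rule subgroup.intro)
      fix p assume p: "p \<in> N"
      have "- p \<in> N"
        using N(4)[of "- 1" p] p poly_alg_closed(6)[OF poly_alg_closed(2)] by simp
      moreover have "inv\<^bsub>add_monoid (poly_alg r S)\<^esub> p = - p"
        using poly_alg_a_inv[of p r S] p N(1) unfolding a_inv_def by blast
      ultimately show "inv\<^bsub>add_monoid (poly_alg r S)\<^esub> p \<in> N"
        by (simp only:)
    qed (use N in auto)
  next
    fix p x :: "'k mpoly" assume p: "p \<in> N" and x: "x \<in> carrier (poly_alg r S)"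
    then have "x * p \<in> N" by (rule N(4)[rotated])
    then show "x \<otimes>\<^bsub>poly_alg r S\<^esub> p \<in> N" "p \<otimes>\<^bsub>poly_alg r S\<^esub> x \<in> N"
      by (simp_all add: mult.commute)
  qed
qed (use gens in blast)

text \<open>
  The polynomials all of whose components lie in the coinvariant ideal form an ideal; it
  contains the generators because components of invariants are invariants.
\<close>

lemma component_coinv_ideal:
  fixes \<zeta> :: "'k::field"
  assumes "p \<in> coinv_ideal \<zeta> d r S"
  shows "component J p \<in> coinv_ideal \<zeta> d r S"
proof -
  let ?I = "coinv_ideal \<zeta> d r S"
  let ?N = "{p \<in> carrier (poly_alg r S). \<forall>J. component J p \<in> ?I}"
  have "?I \<subseteq> ?N"
  proof (rule coinv_ideal_least)
    fix x p :: "'k mpoly" assume x: "x \<in> carrier (poly_alg r S)" and p: "p \<in> ?N"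
    have "component J (x * p) \<in> ?I" for J
    proof -
      let ?A = "mdeg ` keys x"
      let ?B = "mdeg ` keys p"
      \<comment> \<open>A product of components is homogeneous, so each summand either is its component of degree \<open>J\<close> or does not contribute to it.\<close>
      have "x * p = (\<Sum>a\<in>?A. \<Sum>b\<in>?B. component a x * component b p)"
        by (simp add: sum_components flip: sum_product)
      then have "component J (x * p) = (\<Sum>a\<in>?A. \<Sum>b\<in>?B. if J = a + b then component a x * component b p else 0)"
        by (simp only: component_sum component_homogeneous[OF homogeneous_mult[OF homogeneous_component homogeneous_component]])
      also have "\<dots> \<in> ?I"
        using x p by (intro coinv_ideal_sum) (auto intro: coinv_ideal_closed)
      finally show ?thesis .
    qed
    then show "x * p \<in> ?N" using x p by auto
  next
    fix p assume p: "p \<in> invariants \<zeta> d r S" "lookup p 0 = 0"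
    have "component J p \<in> ?I" for J
      using p(2) by (intro invariant_in_coinv_ideal invariants_component[OF p(1)]) (simp add: lookup_component)
    then show "p \<in> ?N"
      using p(1) invariants_subset by blast
  qed (auto simp: component_add intro: coinv_ideal_closed)
  then show ?thesis using assms by blast
qed

text \<open>
  The polynomials that pull back into the coinvariant ideal of \<open>R\<close> form an ideal,
  and it contains the generators because pullback preserves invariants and vanishing constant
  terms.
\<close>

lemma pullback_coinv_ideal:
  assumes "d \<ge> 1" "\<zeta> ^ d = 1" "finite R" "finite S" "\<phi> \<in> FI_hom (integer_mod_group d) R S"
    and "p \<in> coinv_ideal \<zeta> d r S"
  shows "pullback \<zeta> R \<phi> p \<in> coinv_ideal \<zeta> d r R"
proof -
  let ?N = "{p \<in> carrier (poly_alg r S). pullback \<zeta> R \<phi> p \<in> coinv_ideal \<zeta> d r R}"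
  have "coinv_ideal \<zeta> d r S \<subseteq> ?N"
  proof (rule coinv_ideal_least)
    fix p assume p: "p \<in> invariants \<zeta> d r S" "lookup p 0 = 0"
    have "pullback \<zeta> R \<phi> p \<in> coinv_ideal \<zeta> d r R"
      by (rule invariant_in_coinv_ideal[OF invariants_pullback[OF assms(1-5) p(1)] lookup_0_pullback[OF p(2)]])
    then show "p \<in> ?N"
      using p(1) invariants_subset by blast
  qed (auto simp: pullback_hom intro: coinv_ideal_closed pullback_closed)
  then show ?thesis using assms(6) by blast
qed

section \<open>Diagonal coinvariant algebras\<close>

lemma coinv_class_eq:
  assumes "p \<in> carrier (poly_alg r S)"
  shows "coinv_class \<zeta> d r S p = {q. q - p \<in> coinv_ideal \<zeta> d r S}"
proof -
  have "coinv_class \<zeta> d r S p = (\<lambda>h. h + p) ` coinv_ideal \<zeta> d r S"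
    by (auto simp: coinv_class_def a_r_coset_def r_coset_def)
  then show ?thesis
    by (auto simp: image_iff) (metis diff_add_cancel)
qed

lemma coinv_class_eq_iff:
  assumes "p \<in> carrier (poly_alg r S)" "q \<in> carrier (poly_alg r S)"
  shows "coinv_class \<zeta> d r S p = coinv_class \<zeta> d r S q \<longleftrightarrow> p - q \<in> coinv_ideal \<zeta> d r S"
proof
  assume "coinv_class \<zeta> d r S p = coinv_class \<zeta> d r S q"
  moreover have "p \<in> coinv_class \<zeta> d r S p"
    using assms by (simp add: coinv_class_eq coinv_ideal_closed)
  ultimately show "p - q \<in> coinv_ideal \<zeta> d r S"
    using assms by (simp add: coinv_class_eq)
next
  assume *: "p - q \<in> coinv_ideal \<zeta> d r S"
  have "x - p \<in> coinv_ideal \<zeta> d r S \<longleftrightarrow> x - q \<in> coinv_ideal \<zeta> d r S" for x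
    using coinv_ideal_closed(3)[OF _ *, of "x - p"] coinv_ideal_closed(6)[OF _ *, of "x - q"] by auto
  then show "coinv_class \<zeta> d r S p = coinv_class \<zeta> d r S q"
    using assms by (simp add: coinv_class_eq)
qed

lemma coinv_class_eq_zero_iff:
  "p \<in> carrier (poly_alg r S) \<Longrightarrow>
    coinv_class \<zeta> d r S p = coinv_class \<zeta> d r S 0 \<longleftrightarrow> p \<in> coinv_ideal \<zeta> d r S"
  by (simp add: coinv_class_eq_iff)

text \<open>
  The operations on the quotient are unions over all representatives of a coset; this reduces
  them to one representative.
\<close>

lemma Union_coinv_class:
  assumes "p \<in> carrier (poly_alg r S)" "\<And>q. q \<in> coinv_class \<zeta> d r S p \<Longrightarrow> f q = f p"
  shows "(\<Union>q\<in>coinv_class \<zeta> d r S p. f q) = f p"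
proof -
  have "p \<in> coinv_class \<zeta> d r S p"
    using assms(1) by (simp add: coinv_class_eq coinv_ideal_closed)
  then show ?thesis using assms(2) by blast
qed

lemma mem_coinv_class_closed:
  assumes "p \<in> carrier (poly_alg r S)" "q \<in> coinv_class \<zeta> d r S p"
  shows "q \<in> carrier (poly_alg r S)"
  using assms poly_alg_closed(4)[OF coinv_ideal_closed(1) assms(1), of "q - p"] by (simp add: coinv_class_eq)

lemma coinv_alg_carrier: "carrier (coinv_alg \<zeta> d r S) = coinv_class \<zeta> d r S ` carrier (poly_alg r S)"
  by (auto simp: coinv_alg_def ring.defs module.defs FactRing_def A_RCOSETS_def RCOSETS_def coinv_class_def
      a_r_coset_def)

lemma coinv_alg_simps:
  "zero (coinv_alg \<zeta> d r S) = coinv_class \<zeta> d r S 0"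
  "one (coinv_alg \<zeta> d r S) = coinv_class \<zeta> d r S 1"
  "p \<in> carrier (poly_alg r S) \<Longrightarrow> q \<in> carrier (poly_alg r S) \<Longrightarrow>
    coinv_class \<zeta> d r S p \<oplus>\<^bsub>coinv_alg \<zeta> d r S\<^esub> coinv_class \<zeta> d r S q = coinv_class \<zeta> d r S (p + q)"
  "p \<in> carrier (poly_alg r S) \<Longrightarrow> q \<in> carrier (poly_alg r S) \<Longrightarrow>
    coinv_class \<zeta> d r S p \<otimes>\<^bsub>coinv_alg \<zeta> d r S\<^esub> coinv_class \<zeta> d r S q = coinv_class \<zeta> d r S (p * q)"
  "p \<in> carrier (poly_alg r S) \<Longrightarrow>
    c \<odot>\<^bsub>coinv_alg \<zeta> d r S\<^esub> coinv_class \<zeta> d r S p = coinv_class \<zeta> d r S (Const c * p)"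
proof -
  interpret I: ideal "coinv_ideal \<zeta> d r S" "poly_alg r S"
    by (rule ideal_coinv_ideal)
  show "zero (coinv_alg \<zeta> d r S) = coinv_class \<zeta> d r S 0"
    by (simp add: coinv_class_eq) (simp add: coinv_alg_def ring.defs module.defs FactRing_def)
  show "one (coinv_alg \<zeta> d r S) = coinv_class \<zeta> d r S 1"
    by (simp add: coinv_alg_def ring.defs module.defs FactRing_def coinv_class_def)
  assume p: "p \<in> carrier (poly_alg r S)"
  {
    assume q: "q \<in> carrier (poly_alg r S)"
    show "coinv_class \<zeta> d r S p \<oplus>\<^bsub>coinv_alg \<zeta> d r S\<^esub> coinv_class \<zeta> d r S q = coinv_class \<zeta> d r S (p + q)"
      using I.a_rcos_sum[OF p q]
      by (simp add: coinv_alg_def ring.defs module.defs FactRing_def coinv_class_def)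
    show "coinv_class \<zeta> d r S p \<otimes>\<^bsub>coinv_alg \<zeta> d r S\<^esub> coinv_class \<zeta> d r S q = coinv_class \<zeta> d r S (p * q)"
      using I.rcoset_mult_add[OF p q]
      by (simp add: coinv_alg_def ring.defs module.defs FactRing_def coinv_class_def)
  }
  have "c \<odot>\<^bsub>coinv_alg \<zeta> d r S\<^esub> coinv_class \<zeta> d r S p
      = (\<Union>q\<in>coinv_class \<zeta> d r S p. coinv_class \<zeta> d r S (Const c * q))"
    by (simp add: coinv_alg_def ring.defs module.defs)
  also have "\<dots> = coinv_class \<zeta> d r S (Const c * p)"
  proof (rule Union_coinv_class[OF p])
    fix q assume q: "q \<in> coinv_class \<zeta> d r S p"
    then have "Const c * (q - p) \<in> coinv_ideal \<zeta> d r S"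
      using p by (intro coinv_ideal_closed(4)) (auto simp: coinv_class_eq)
    then show "coinv_class \<zeta> d r S (Const c * q) = coinv_class \<zeta> d r S (Const c * p)"
      using p mem_coinv_class_closed[OF p q] by (simp add: coinv_class_eq_iff right_diff_distrib)
  qed
  finally show "c \<odot>\<^bsub>coinv_alg \<zeta> d r S\<^esub> coinv_class \<zeta> d r S p = coinv_class \<zeta> d r S (Const c * p)" .
qed

lemma coinv_map_class:
  assumes "d \<ge> 1" "\<zeta> ^ d = 1" "finite R" "finite S" "\<phi> \<in> FI_hom (integer_mod_group d) R S"
    and p: "p \<in> carrier (poly_alg r S)"
  shows "coinv_map \<zeta> d r R S \<phi> (coinv_class \<zeta> d r S p) = coinv_class \<zeta> d r R (pullback \<zeta> R \<phi> p)"
  unfolding coinv_map_def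
proof (rule Union_coinv_class[OF p])
  fix q assume q: "q \<in> coinv_class \<zeta> d r S p"
  then have "pullback \<zeta> R \<phi> (q - p) \<in> coinv_ideal \<zeta> d r R"
    using p by (intro pullback_coinv_ideal[OF assms(1-5)]) (simp add: coinv_class_eq)
  then show "coinv_class \<zeta> d r R (pullback \<zeta> R \<phi> q) = coinv_class \<zeta> d r R (pullback \<zeta> R \<phi> p)"
    using p mem_coinv_class_closed[OF p q] by (simp add: coinv_class_eq_iff pullback_closed pullback_hom)
qed

lemma ring_of_type_simps [simp]:
  "carrier (ring_of_type_algebra :: 'k::field ring) = UNIV"
  "monoid.mult (ring_of_type_algebra :: 'k ring) = (*)" "one (ring_of_type_algebra :: 'k ring) = 1"
  "ring.zero (ring_of_type_algebra :: 'k ring) = 0" "add (ring_of_type_algebra :: 'k ring) = (+)"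
  by (simp_all add: ring_of_type_algebra_def)

lemma algebra_coinv_alg: "Module.algebra (ring_of_type_algebra :: 'k::field ring) (coinv_alg (\<zeta> :: 'k) d r S)"
proof -
  let ?A = "coinv_alg \<zeta> d r S"
  note [simp] = coinv_alg_carrier coinv_alg_simps
  have cr: "cring ?A"
  proof (rule cringI)
    show "abelian_group ?A"
    proof (rule abelian_groupI)
      fix x assume "x \<in> carrier ?A"
      then obtain p where "p \<in> carrier (poly_alg r S)" "x = coinv_class \<zeta> d r S p" by auto
      then show "\<exists>y\<in>carrier ?A. y \<oplus>\<^bsub>?A\<^esub> x = \<zero>\<^bsub>?A\<^esub>"
        by (intro bexI[of _ "coinv_class \<zeta> d r S (- p)"]) auto
    qed (auto simp: add_ac)
    show "comm_monoid ?A"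
      by (rule comm_monoidI) (auto simp: mult_ac)
  qed (auto simp: distrib_right)
  show ?thesis
    by (rule algebraI[OF cring_from_type_algebra cr])
       (auto simp: distrib_left distrib_right mult.assoc Const_one simp flip: Const_add Const_mult)
qed

lemma vectorspace_coinv_alg: "vectorspace (ring_of_type_algebra :: 'k::field ring) (coinv_alg (\<zeta> :: 'k) d r S)"
  using algebra.module[OF algebra_coinv_alg] field_from_type_algebra by (rule vectorspace.intro)

lemma mem_coinv_piece:
  "x \<in> coinv_piece \<zeta> d r S J \<longleftrightarrow>
    (\<exists>p. p \<in> carrier (poly_alg r S) \<and> homogeneous J p \<and> x = coinv_class \<zeta> d r S p)"
  by (auto simp: coinv_piece_def)

lemma subspace_coinv_piece:
  "VectorSpace.subspace (ring_of_type_algebra :: 'k::field ring) (coinv_piece (\<zeta> :: 'k) d r S J) (coinv_alg \<zeta> d r S)"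
proof (rule subspace.intro[OF vectorspace_coinv_alg], rule submodule.intro[OF algebra.module[OF algebra_coinv_alg]])
  let ?A = "coinv_alg \<zeta> d r S"
  show "coinv_piece \<zeta> d r S J \<subseteq> carrier ?A"
    by (auto simp: coinv_alg_carrier mem_coinv_piece)
  show "\<zero>\<^bsub>?A\<^esub> \<in> coinv_piece \<zeta> d r S J"
    unfolding mem_coinv_piece coinv_alg_simps by (intro exI[of _ 0]) simp
  fix v w assume "v \<in> coinv_piece \<zeta> d r S J" "w \<in> coinv_piece \<zeta> d r S J"
  then obtain p q where "p \<in> carrier (poly_alg r S)" "homogeneous J p" "v = coinv_class \<zeta> d r S p"
    "q \<in> carrier (poly_alg r S)" "homogeneous J q" "w = coinv_class \<zeta> d r S q"
    unfolding mem_coinv_piece by blast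
  then show "v \<oplus>\<^bsub>?A\<^esub> w \<in> coinv_piece \<zeta> d r S J"
    unfolding mem_coinv_piece by (intro exI[of _ "p + q"]) (simp add: coinv_alg_simps homogeneous_add)
next
  let ?A = "coinv_alg \<zeta> d r S"
  fix c v assume "v \<in> coinv_piece \<zeta> d r S J"
  then obtain p where "p \<in> carrier (poly_alg r S)" "homogeneous J p" "v = coinv_class \<zeta> d r S p"
    unfolding mem_coinv_piece by blast
  then show "c \<odot>\<^bsub>?A\<^esub> v \<in> coinv_piece \<zeta> d r S J"
    unfolding mem_coinv_piece by (intro exI[of _ "Const c * p"]) (simp add: coinv_alg_simps homogeneous_Const_mult)
qed

lemma coinv_finsum:
  assumes "finite A" "\<And>J. J \<in> A \<Longrightarrow> f J = coinv_class \<zeta> d r S (q J)" "\<And>J. J \<in> A \<Longrightarrow> q J \<in> carrier (poly_alg r S)"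
  shows "(\<Oplus>\<^bsub>coinv_alg \<zeta> d r S\<^esub>J\<in>A. f J) = coinv_class \<zeta> d r S (\<Sum>J\<in>A. q J)"
proof -
  interpret A: Module.algebra ring_of_type_algebra "coinv_alg \<zeta> d r S" by (rule algebra_coinv_alg)
  show ?thesis
    using assms
  proof (induction A)
    case empty
    then show ?case by (simp add: coinv_alg_simps)
  next
    case (insert J A)
    have "f \<in> A \<rightarrow> carrier (coinv_alg \<zeta> d r S)" "f J \<in> carrier (coinv_alg \<zeta> d r S)"
      using insert.prems by (auto simp: coinv_alg_carrier)
    moreover have "(\<Sum>J\<in>A. q J) \<in> carrier (poly_alg r S)"
      using insert.prems by (intro poly_alg_sum) auto
    ultimately show ?case
      using insert by (simp add: coinv_alg_simps)
  qed
qed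

section \<open>The grading\<close>

text \<open>
  Existence: decompose a representative into its components.  Uniqueness: for two
  decompositions, the difference of representatives lies in the ideal, hence so do its
  components, and these compare the decompositions degree by degree.
\<close>

lemma graded_decomposition:
  assumes "x \<in> carrier (coinv_alg \<zeta> d r S)"
  shows "\<exists>!f. f \<in> (\<Pi>\<^sub>E J\<in>multidegrees r. coinv_piece \<zeta> d r S J) \<and>
    finite {J\<in>multidegrees r. f J \<noteq> \<zero>\<^bsub>coinv_alg \<zeta> d r S\<^esub>} \<and>
    x = (\<Oplus>\<^bsub>coinv_alg \<zeta> d r S\<^esub>J\<in>{J\<in>multidegrees r. f J \<noteq> \<zero>\<^bsub>coinv_alg \<zeta> d r S\<^esub>}. f J)"
    (is "\<exists>!f. ?P f")
proof -
  let ?I = "coinv_ideal \<zeta> d r S" and ?D = "multidegrees r"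
  let ?cls = "coinv_class \<zeta> d r S"
  let ?supp = "\<lambda>f. {J\<in>?D. f J \<noteq> ?cls 0}"
  obtain p where p: "p \<in> carrier (poly_alg r S)" "x = ?cls p"
    using assms by (auto simp: coinv_alg_carrier)
  define F where "F = (\<lambda>J\<in>?D. ?cls (component J p))"
  have P: "?P f \<longleftrightarrow> f \<in> (\<Pi>\<^sub>E J\<in>?D. coinv_piece \<zeta> d r S J) \<and> finite (?supp f) \<and>
      x = (\<Oplus>\<^bsub>coinv_alg \<zeta> d r S\<^esub>J\<in>?supp f. f J)" for f
    by (simp only: coinv_alg_simps)
  show ?thesis
  proof (rule ex1I)
    show "?P F"
      unfolding P
    proof (intro conjI)
      show "F \<in> (\<Pi>\<^sub>E J\<in>?D. coinv_piece \<zeta> d r S J)"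
        using p(1) unfolding F_def
        by (intro restrict_PiE[THEN iffD2] funcsetI) (simp add: coinv_piece_def)
      let ?B = "mdeg ` keys p"
      have B: "finite ?B" "?B \<subseteq> ?D"
        using p(1) mdeg_in_multidegrees by (auto simp: poly_alg_iff)
      have "component J p = 0" if "J \<notin> ?B" for J
        using that keys_component[of J p] by (intro poly_mapping_eqI) (auto simp: lookup_component in_keys_iff)
      then have sub: "?supp F \<subseteq> ?B"
        by (force simp: F_def)
      then show fin: "finite (?supp F)"
        using B(1) by (rule finite_subset)
      have "p - (\<Sum>J\<in>?supp F. component J p) = (\<Sum>J\<in>?B. component J p) - (\<Sum>J\<in>?supp F. component J p)"
        by (simp add: sum_components)
      also have "\<dots> = (\<Sum>J\<in>?B - ?supp F. component J p)"
        using sum.subset_diff[OF sub B(1), of "\<lambda>J. component J p"] by simp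
      also have "\<dots> \<in> ?I"
      proof (rule coinv_ideal_sum)
        fix J assume "J \<in> ?B - ?supp F"
        then have "?cls (component J p) = ?cls 0"
          using B(2) by (auto simp: F_def)
        then show "component J p \<in> ?I"
          using p(1) by (simp add: coinv_class_eq_zero_iff)
      qed
      finally have "x = ?cls (\<Sum>J\<in>?supp F. component J p)"
        using p by (subst p(2), subst coinv_class_eq_iff) auto
      also have "\<dots> = (\<Oplus>\<^bsub>coinv_alg \<zeta> d r S\<^esub>J\<in>?supp F. F J)"
        using p(1) fin by (intro coinv_finsum[symmetric]) (auto simp: F_def)
      finally show "x = (\<Oplus>\<^bsub>coinv_alg \<zeta> d r S\<^esub>J\<in>?supp F. F J)" .
    qed
  next
    fix f assume "?P f"
    then have f: "f \<in> (\<Pi>\<^sub>E J\<in>?D. coinv_piece \<zeta> d r S J)" "finite (?supp f)"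
      "x = (\<Oplus>\<^bsub>coinv_alg \<zeta> d r S\<^esub>J\<in>?supp f. f J)"
      unfolding P by blast+
    have "\<forall>J\<in>?D. \<exists>q. q \<in> carrier (poly_alg r S) \<and> homogeneous J q \<and> f J = ?cls q"
      using f(1) by (auto simp: mem_coinv_piece dest!: PiE_mem)
    then obtain q where q: "\<And>J. J \<in> ?D \<Longrightarrow> q J \<in> carrier (poly_alg r S)" "\<And>J. J \<in> ?D \<Longrightarrow> homogeneous J (q J)"
      "\<And>J. J \<in> ?D \<Longrightarrow> f J = ?cls (q J)"
      by metis
    have "x = ?cls (\<Sum>J\<in>?supp f. q J)"
      unfolding f(3) using f(2) q by (intro coinv_finsum) auto
    then have "p - (\<Sum>J\<in>?supp f. q J) \<in> ?I"
      using p q(1) by (subst (asm) p(2), subst (asm) coinv_class_eq_iff) auto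
    then have comp: "component L (p - (\<Sum>J\<in>?supp f. q J)) \<in> ?I" for L
      by (rule component_coinv_ideal)
    have "f L = F L" if L: "L \<in> ?D" for L
    proof -
      have "component L (\<Sum>J\<in>?supp f. q J) = (\<Sum>J\<in>?supp f. if L = J then q J else 0)"
        unfolding component_sum using q(2) by (intro sum.cong) (auto simp: component_homogeneous)
      also have "\<dots> = (if L \<in> ?supp f then q L else 0)"
        using f(2) by simp
      finally have *: "component L p - (if L \<in> ?supp f then q L else 0) \<in> ?I"
        using comp[of L] by (simp add: component_diff)
      show ?thesis
      proof (cases "L \<in> ?supp f")
        case True
        with * have "?cls (component L p) = ?cls (q L)"
          using p(1) q(1)[OF L] by (subst coinv_class_eq_iff) auto
        then show ?thesis using L q(3) by (simp add: F_def)
      next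
        case False
        with * have "?cls (component L p) = ?cls 0"
          using p(1) by (subst coinv_class_eq_zero_iff) auto
        then show ?thesis using L False by (simp add: F_def)
      qed
    qed
    then show "f = F"
      using f(1) by (intro extensionalityI[of f ?D]) (auto simp: F_def PiE_def)
  qed
qed

lemma multidegrees_add: "I \<in> multidegrees r \<Longrightarrow> J \<in> multidegrees r \<Longrightarrow> I + J \<in> multidegrees r"
  unfolding multidegrees_def using keys_add[of I J] by blast

lemma graded_algebra_coinv:
  "graded_algebra (ring_of_type_algebra :: 'k::field ring) (multidegrees r) (coinv_alg (\<zeta> :: 'k) d r S)
    (coinv_piece \<zeta> d r S)"
proof (rule graded_algebra.intro[OF algebra_coinv_alg], rule graded_algebra_axioms.intro)
  show "\<one>\<^bsub>coinv_alg \<zeta> d r S\<^esub> \<in> coinv_piece \<zeta> d r S 0"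
    unfolding mem_coinv_piece coinv_alg_simps
    by (intro exI[of _ 1]) (simp flip: Const_one)
  fix I J x y assume "x \<in> coinv_piece \<zeta> d r S I" "y \<in> coinv_piece \<zeta> d r S J"
  then obtain p q where "p \<in> carrier (poly_alg r S)" "homogeneous I p" "x = coinv_class \<zeta> d r S p"
    "q \<in> carrier (poly_alg r S)" "homogeneous J q" "y = coinv_class \<zeta> d r S q"
    unfolding mem_coinv_piece by blast
  then show "x \<otimes>\<^bsub>coinv_alg \<zeta> d r S\<^esub> y \<in> coinv_piece \<zeta> d r S (I + J)"
    unfolding mem_coinv_piece by (intro exI[of _ "p * q"]) (simp add: coinv_alg_simps homogeneous_mult)
qed (simp_all add: multidegrees_add subspace_coinv_piece graded_decomposition, simp add: multidegrees_def)

section \<open>Functoriality\<close>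

lemma coinv_map_hom:
  fixes \<zeta> :: "'k::field"
  assumes "d \<ge> 1" "\<zeta> ^ d = 1" "finite R" "finite S" "\<phi> \<in> FI_hom (integer_mod_group d) R S"
  shows "coinv_map \<zeta> d r R S \<phi> \<in> graded_algebra_hom ring_of_type_algebra (multidegrees r)
    (coinv_alg \<zeta> d r S) (coinv_piece \<zeta> d r S) (coinv_alg \<zeta> d r R) (coinv_piece \<zeta> d r R)"
proof -
  note map = coinv_map_class[OF assms]
  have "coinv_map \<zeta> d r R S \<phi> \<in> ring_hom (coinv_alg \<zeta> d r S) (coinv_alg \<zeta> d r R)"
    by (rule ring_hom_memI)
       (auto simp: coinv_alg_carrier coinv_alg_simps map pullback_hom pullback_closed)
  moreover have "coinv_map \<zeta> d r R S \<phi> \<in> module_hom ring_of_type_algebra (coinv_alg \<zeta> d r S) (coinv_alg \<zeta> d r R)"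
    by (auto simp: module_hom_def coinv_alg_carrier coinv_alg_simps map pullback_hom pullback_closed)
  moreover have "coinv_map \<zeta> d r R S \<phi> ` coinv_piece \<zeta> d r S J \<subseteq> coinv_piece \<zeta> d r R J" for J
    unfolding coinv_piece_def using map by (auto simp: homogeneous_pullback pullback_closed intro!: imageI)
  ultimately show ?thesis
    by (simp add: graded_algebra_hom_def)
qed

lemma primitive_root_power: "primitive_root d \<zeta> \<Longrightarrow> \<zeta> ^ d = 1"
  by (simp add: primitive_root_def)

lemma graded_co_FI_algebra_coinv:
  fixes \<zeta> :: "'k::field"
  assumes "d \<ge> 1" "\<zeta> ^ d = 1"
  shows "graded_co_FI_algebra (integer_mod_group d) (ring_of_type_algebra :: 'k ring) (multidegrees r)
    (coinv_alg \<zeta> d r) (coinv_piece \<zeta> d r) (coinv_map \<zeta> d r)"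
proof (rule graded_co_FI_algebra.intro)
  fix S and x :: "'k mpoly set" assume S: "finite S" and "x \<in> carrier (coinv_alg \<zeta> d r S)"
  then obtain p where p: "p \<in> carrier (poly_alg r S)" "x = coinv_class \<zeta> d r S p"
    by (auto simp: coinv_alg_carrier)
  have "FI_id (integer_mod_group d) S \<in> FI_hom (integer_mod_group d) S S"
    by (auto simp: FI_id_def FI_hom_def)
  then show "coinv_map \<zeta> d r S S (FI_id (integer_mod_group d) S) x = x"
    using p coinv_map_class[OF assms S S _ p(1)] by (simp add: pullback_id[OF S])
next
  fix Q R S \<phi> \<psi> and x :: "'k mpoly set"
  assume *: "finite Q" "finite R" "finite S"
    "\<phi> \<in> FI_hom (integer_mod_group d) Q R" "\<psi> \<in> FI_hom (integer_mod_group d) R S"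
    and "x \<in> carrier (coinv_alg \<zeta> d r S)"
  then obtain p where p: "p \<in> carrier (poly_alg r S)" "x = coinv_class \<zeta> d r S p"
    by (auto simp: coinv_alg_carrier)
  have "FI_comp (integer_mod_group d) Q \<psi> \<phi> \<in> FI_hom (integer_mod_group d) Q S"
    using *(4,5) assms(1)
    by (auto simp: FI_comp_def FI_hom_def carrier_integer_mod_group compose_def inj_on_def PiE_iff)
  then show "coinv_map \<zeta> d r Q S (FI_comp (integer_mod_group d) Q \<psi> \<phi>) x =
      coinv_map \<zeta> d r Q R \<phi> (coinv_map \<zeta> d r R S \<psi> x)"
    using p * by (simp add: coinv_map_class[OF assms] pullback_comp[OF assms] pullback_closed)
qed (simp_all only: graded_algebra_coinv coinv_map_hom[OF assms] group_integer_mod_group field_from_type_algebra)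

section \<open>Duals of graded pieces\<close>

lemma dual_space_simps:
  assumes "ring K"
  shows "f \<oplus>\<^bsub>dual_space K V\<^esub> g = (\<lambda>x\<in>carrier V. f x \<oplus>\<^bsub>K\<^esub> g x)"
    "c \<odot>\<^bsub>dual_space K V\<^esub> f = (\<lambda>x\<in>carrier V. c \<otimes>\<^bsub>K\<^esub> f x)"
  using assms by (simp_all add: dual_space_def ring.func_space_def)

lemma mem_dual_space:
  "f \<in> carrier (dual_space K V) \<longleftrightarrow> f \<in> carrier V \<rightarrow>\<^sub>E carrier K \<and>
    (\<forall>x\<in>carrier V. \<forall>y\<in>carrier V. f (x \<oplus>\<^bsub>V\<^esub> y) = f x \<oplus>\<^bsub>K\<^esub> f y) \<and>
    (\<forall>c\<in>carrier K. \<forall>x\<in>carrier V. f (c \<odot>\<^bsub>V\<^esub> x) = c \<otimes>\<^bsub>K\<^esub> f x)"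
  by (simp add: dual_space_def)

lemma vectorspace_dual_space:
  assumes "vectorspace K V"
  shows "vectorspace K (dual_space K V)"
proof -
  interpret V: vectorspace K V by fact
  interpret W: vectorspace K "V.func_space (carrier V)" by (rule V.func_space_is_vs)
  let ?L = "carrier (dual_space K V)"
  have "VectorSpace.subspace K ?L (V.func_space (carrier V))"
  proof (rule subspace.intro[OF V.func_space_is_vs], rule submodule.intro[OF W.module.module_axioms])
    show "?L \<subseteq> carrier (V.func_space (carrier V))"
      by (auto simp: mem_dual_space V.func_space_def)
    show "\<zero>\<^bsub>V.func_space (carrier V)\<^esub> \<in> ?L"
      by (auto simp: mem_dual_space V.func_space_def)
    have val: "f x \<in> carrier K" if "f \<in> ?L" "x \<in> carrier V" for f x
      using that by (auto simp: mem_dual_space)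
    show "f \<oplus>\<^bsub>V.func_space (carrier V)\<^esub> g \<in> ?L" if "f \<in> ?L" "g \<in> ?L" for f g
      using that val[OF that(1)] val[OF that(2)]
      by (auto simp: mem_dual_space V.func_space_def V.R.a_ac V.R.r_distr)
    show "c \<odot>\<^bsub>V.func_space (carrier V)\<^esub> f \<in> ?L" if "c \<in> carrier K" "f \<in> ?L" for c f
      using that val[OF that(2)]
      by (auto simp: mem_dual_space V.func_space_def V.R.m_ac V.R.r_distr)
  qed
  from W.subspace_is_vs[OF this] show ?thesis
    by (simp add: dual_space_def)
qed


lemma (in graded_co_FI_algebra) vectorspace_piece:
  assumes "J \<in> D" "finite S"
  shows "vectorspace K (piece J S)"
proof -
  interpret graded_algebra K D "A S" "P S" by (rule graded_algebra_obj[OF assms(2)])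
  have "VectorSpace.subspace K (P S J) (A S)"
    by (rule piece_subspace[OF assms(1)])
  then show ?thesis
    unfolding piece_def using vectorspace.subspace_is_vs subspace.vs by blast
qed

lemma (in graded_co_FI_algebra) piece_simps [simp]:
  "carrier (piece J S) = P S J" "add (piece J S) = add (A S)" "module.smult (piece J S) = module.smult (A S)"
  by (simp_all add: piece_def)

lemma (in graded_co_FI_algebra) piece_subset: "J \<in> D \<Longrightarrow> finite S \<Longrightarrow> P S J \<subseteq> carrier (A S)"
  using graded_algebra.piece_subspace[OF graded_algebra_obj] submodule.subset subspace.submod by blast

lemma (in graded_co_FI_algebra) map_piece:
  assumes "finite R" "finite S" "\<phi> \<in> FI_hom G R S" "J \<in> D"
  shows "x \<in> P S J \<Longrightarrow> F R S \<phi> x \<in> P R J"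
    "x \<in> P S J \<Longrightarrow> y \<in> P S J \<Longrightarrow> F R S \<phi> (x \<oplus>\<^bsub>A S\<^esub> y) = F R S \<phi> x \<oplus>\<^bsub>A R\<^esub> F R S \<phi> y"
    "c \<in> carrier K \<Longrightarrow> x \<in> P S J \<Longrightarrow> F R S \<phi> (c \<odot>\<^bsub>A S\<^esub> x) = c \<odot>\<^bsub>A R\<^esub> F R S \<phi> x"
proof -
  have hom: "F R S \<phi> ` P S J \<subseteq> P R J" "F R S \<phi> \<in> module_hom K (A S) (A R)"
    using graded_hom[OF assms(1-3)] assms(4) by (auto simp: graded_algebra_hom_def)
  note sub = subsetD[OF piece_subset[OF assms(4,2)]]
  show "x \<in> P S J \<Longrightarrow> F R S \<phi> x \<in> P R J"
    using hom(1) by blast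
  show "x \<in> P S J \<Longrightarrow> y \<in> P S J \<Longrightarrow> F R S \<phi> (x \<oplus>\<^bsub>A S\<^esub> y) = F R S \<phi> x \<oplus>\<^bsub>A R\<^esub> F R S \<phi> y"
    by (rule module_hom_add[OF hom(2) sub sub])
  show "c \<in> carrier K \<Longrightarrow> x \<in> P S J \<Longrightarrow> F R S \<phi> (c \<odot>\<^bsub>A S\<^esub> x) = c \<odot>\<^bsub>A R\<^esub> F R S \<phi> x"
    by (rule module_hom_smult[OF hom(2) _ sub])
qed

text \<open>
  The functor \<open>F\<close> is contravariant, and precomposition reverses arrows once more.
\<close>

lemma (in graded_co_FI_algebra) FI_module_dual:
  assumes J: "J \<in> D"
  shows "FI_module G K (\<lambda>S. dual_space K (piece J S)) (dual_map (piece J) F)"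
proof (rule FI_module.intro[OF FI_group])
  interpret K: field K by (rule base_field)
  show "vectorspace K (dual_space K (piece J S))" if "finite S" for S
    by (rule vectorspace_dual_space[OF vectorspace_piece[OF J that]])
  show "dual_map (piece J) F R S \<phi> \<in> module_hom K (dual_space K (piece J R)) (dual_space K (piece J S))"
    if RS: "finite R" "finite S" "\<phi> \<in> FI_hom G R S" for R S \<phi>
  proof -
    note map = map_piece[OF RS J]
    interpret PS: vectorspace K "piece J S" by (rule vectorspace_piece[OF J RS(2)])
    have closed: "x \<oplus>\<^bsub>A S\<^esub> y \<in> P S J" if "x \<in> P S J" "y \<in> P S J" for x y
      using that PS.M.a_closed[of x y] by simp
    have closed': "c \<odot>\<^bsub>A S\<^esub> x \<in> P S J" if "c \<in> carrier K" "x \<in> P S J" for c x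
      using that PS.smult_closed[of c x] by simp
    show ?thesis
      unfolding module_hom_def
    proof (intro CollectI conjI allI impI funcsetI; (elim conjE)?)
      fix f assume f: "f \<in> carrier (dual_space K (piece J R))"
      then have "f (F R S \<phi> x) \<in> carrier K" if "x \<in> P S J" for x
        using map(1)[OF that] by (auto simp: mem_dual_space)
      then show "dual_map (piece J) F R S \<phi> f \<in> carrier (dual_space K (piece J S))"
        using f by (simp add: mem_dual_space dual_map_def map closed closed')
    next
      fix f g
      show "dual_map (piece J) F R S \<phi> (f \<oplus>\<^bsub>dual_space K (piece J R)\<^esub> g) =
          dual_map (piece J) F R S \<phi> f \<oplus>\<^bsub>dual_space K (piece J S)\<^esub> dual_map (piece J) F R S \<phi> g"
        by (auto simp: dual_map_def dual_space_simps K.ring_axioms map intro!: restrict_ext)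
    next
      fix c f
      show "dual_map (piece J) F R S \<phi> (c \<odot>\<^bsub>dual_space K (piece J R)\<^esub> f) =
          c \<odot>\<^bsub>dual_space K (piece J S)\<^esub> dual_map (piece J) F R S \<phi> f"
        by (auto simp: dual_map_def dual_space_simps K.ring_axioms map intro!: restrict_ext)
    qed
  qed
  show "dual_map (piece J) F S S (FI_id G S) v = v"
    if S: "finite S" and v: "v \<in> carrier (dual_space K (piece J S))" for S v
  proof -
    have "dual_map (piece J) F S S (FI_id G S) v = restrict v (P S J)"
      unfolding dual_map_def piece_simps
      by (intro restrict_ext) (simp add: map_id[OF S subsetD[OF piece_subset[OF J S]]])
    also have "\<dots> = v"
      using v by (intro extensional_restrict) (simp add: mem_dual_space PiE_def)
    finally show ?thesis .
  qed
  show "dual_map (piece J) F Q S (FI_comp G Q \<psi> \<phi>) v =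
      dual_map (piece J) F R S \<psi> (dual_map (piece J) F Q R \<phi> v)"
    if *: "finite Q" "finite R" "finite S" "\<phi> \<in> FI_hom G Q R" "\<psi> \<in> FI_hom G R S" for Q R S \<phi> \<psi> v
    unfolding dual_map_def piece_simps
  proof (intro restrict_ext)
    fix x assume x: "x \<in> P S J"
    then have "F Q S (FI_comp G Q \<psi> \<phi>) x = F Q R \<phi> (F R S \<psi> x)"
      by (intro map_comp[OF *] subsetD[OF piece_subset[OF J *(3)]])
    then show "v (F Q S (FI_comp G Q \<psi> \<phi>) x) = (\<lambda>x\<in>P R J. v (F Q R \<phi> x)) (F R S \<psi> x)"
      using map_piece(1)[OF *(2,3,5) J x] by simp
  qed
qed

section \<open>Monomials as words\<close>

definition monomials :: "nat \<Rightarrow> (nat \<Rightarrow>\<^sub>0 nat) \<Rightarrow> nat set \<Rightarrow> (nat \<times> nat \<Rightarrow>\<^sub>0 nat) set" where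
  "monomials r J S = {m. keys m \<subseteq> {1..r} \<times> S \<and> mdeg m = J}"

lemma single_monomial [simp]:
  assumes "m \<in> monomials r J S"
  shows "single m c \<in> carrier (poly_alg r S)" "homogeneous J (single m c)"
  using assms by (auto simp: monomials_def poly_alg_iff homogeneous_iff)

lemma keys_homogeneous_subset:
  "p \<in> carrier (poly_alg r S) \<Longrightarrow> homogeneous J p \<Longrightarrow> keys p \<subseteq> monomials r J S"
  by (auto simp: monomials_def poly_alg_iff homogeneous_iff)

lemma lookup_le_mdeg: "lookup m (s, j) \<le> lookup (mdeg m) s"
proof (cases "(s, j) \<in> keys m")
  case True
  with finite_row show ?thesis
    unfolding lookup_mdeg by (intro member_le_sum) auto
qed (simp add: in_keys_iff)

lemma finite_monomials:
  assumes "finite S"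
  shows "finite (monomials r J S)"
proof (rule finite_imageD)
  let ?V = "{1..r} \<times> S"
  have "(\<lambda>m. restrict (lookup m) ?V) ` monomials r J S \<subseteq> (\<Pi>\<^sub>E v\<in>?V. {..lookup J (fst v)})"
    using lookup_le_mdeg by (intro image_subsetI restrict_PiE[THEN iffD2] funcsetI) (auto simp: monomials_def)
  then show "finite ((\<lambda>m. restrict (lookup m) ?V) ` monomials r J S)"
    by (rule finite_subset) (use assms in \<open>auto intro!: finite_PiE\<close>)
  show "inj_on (\<lambda>m. restrict (lookup m) ?V) (monomials r J S)"
  proof (rule inj_onI)
    fix m n assume mn: "m \<in> monomials r J S" "n \<in> monomials r J S"
      and eq: "restrict (lookup m) ?V = restrict (lookup n) ?V"
    show "m = n"
    proof (rule poly_mapping_eqI)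
      fix v
      show "lookup m v = lookup n v"
      proof (cases "v \<in> ?V")
        case True
        then show ?thesis using fun_cong[OF eq, of v] by simp
      next
        case False
        then have "v \<notin> keys m" "v \<notin> keys n" using mn by (auto simp: monomials_def)
        then show ?thesis by (simp add: in_keys_iff)
      qed
    qed
  qed
qed

text \<open>
  Every index that occurs in \<open>m\<close> contributes at least one to the total degree,
  which is the sum of the entries of \<open>J\<close>.
\<close>

lemma card_support_le:
  assumes "m \<in> monomials r J S"
  shows "card (snd ` keys m) \<le> (\<Sum>s\<in>keys J. lookup J s)"
proof -
  have J: "J = mdeg m" using assms by (simp add: monomials_def)
  have fst: "fst v \<in> keys J" if "v \<in> keys m" for v
    using lookup_le_mdeg[of m "fst v" "snd v"] that by (auto simp: in_keys_iff J)
  have "card (snd ` keys m) \<le> card (keys m)"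
    by (rule card_image_le) simp
  also have "\<dots> = (\<Sum>v\<in>keys m. 1)" by simp
  also have "\<dots> \<le> (\<Sum>v\<in>keys m. lookup m v)"
    by (rule sum_mono) (auto simp: in_keys_iff Suc_le_eq)
  also have "\<dots> = (\<Sum>v\<in>keys m. \<Sum>s\<in>keys J. if fst v = s then lookup m v else 0)"
    using fst by (intro sum.cong) auto
  also have "\<dots> = (\<Sum>s\<in>keys J. \<Sum>v\<in>keys m. if fst v = s then lookup m v else 0)"
    by (rule sum.swap)
  also have "\<dots> = (\<Sum>s\<in>keys J. lookup J s)"
    by (intro sum.cong) (simp_all add: J mdeg_def lookup_sum lookup_single when_def)
  finally show ?thesis .
qed

text \<open>
  The columns of exponents are the letters of the word of a monomial; the letter zero belongs to
  an index that does not occur in the monomial.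
\<close>

definition column :: "(nat \<times> nat \<Rightarrow>\<^sub>0 nat) \<Rightarrow> nat \<Rightarrow> nat \<Rightarrow> nat" where
  "column m j = (\<lambda>s. lookup m (s, j))"

definition columns :: "nat set \<Rightarrow> (nat \<times> nat \<Rightarrow>\<^sub>0 nat) \<Rightarrow> (nat \<Rightarrow> nat) list" where
  "columns S m = map (column m) (sorted_list_of_set S)"

lemma columns_letters:
  assumes "m \<in> monomials r J S"
  shows "set (columns S m) \<subseteq> {c. \<forall>s. (s \<in> keys J \<longrightarrow> c s \<in> {..\<Sum>s\<in>keys J. lookup J s}) \<and> (s \<notin> keys J \<longrightarrow> c s = 0)}"
proof
  fix c assume "c \<in> set (columns S m)"
  then obtain j where c: "c = (\<lambda>s. lookup m (s, j))" by (auto simp: columns_def column_def)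
  have "c s \<le> lookup J s" for s
    using lookup_le_mdeg[of m s j] assms by (simp add: c monomials_def)
  moreover have "lookup J s \<le> (\<Sum>s\<in>keys J. lookup J s)" if "s \<in> keys J" for s
    using that by (intro member_le_sum) auto
  ultimately show "c \<in> {c. \<forall>s. (s \<in> keys J \<longrightarrow> c s \<in> {..\<Sum>s\<in>keys J. lookup J s}) \<and> (s \<notin> keys J \<longrightarrow> c s = 0)}"
    by (auto simp: in_keys_iff intro: order_trans) (metis le_zero_eq)
qed

lemma columns_nonzero:
  assumes "m \<in> monomials r J S" "finite S"
  shows "length (filter (\<lambda>c. c \<noteq> (\<lambda>_. 0)) (columns S m)) \<le> (\<Sum>s\<in>keys J. lookup J s)"
proof -
  let ?xs = "filter (\<lambda>j. column m j \<noteq> (\<lambda>_. 0)) (sorted_list_of_set S)"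
  have "length (filter (\<lambda>c. c \<noteq> (\<lambda>_. 0)) (columns S m)) = length ?xs"
    by (simp add: columns_def filter_map comp_def)
  also have "\<dots> = card (set ?xs)"
    by (rule distinct_card[symmetric]) simp
  also have "\<dots> \<le> card (snd ` keys m)"
  proof (rule card_mono)
    show "set ?xs \<subseteq> snd ` keys m"
    proof
      fix j assume "j \<in> set ?xs"
      then obtain s where "(s, j) \<in> keys m" by (auto simp: column_def fun_eq_iff in_keys_iff)
      then show "j \<in> snd ` keys m" by force
    qed
  qed simp
  finally show ?thesis using card_support_le[OF assms(1)] by linarith
qed

text \<open>
  The monomial obtained from \<open>m\<close> by relabelling along the inverse of
  \<open>a\<close>.  It is meaningful only if every index that occurs in \<open>m\<close> lies
  in the image of \<open>a\<close>.
\<close>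

definition pull_monomial :: "(nat \<Rightarrow> nat) \<Rightarrow> nat set \<Rightarrow> (nat \<times> nat \<Rightarrow>\<^sub>0 nat) \<Rightarrow> nat \<times> nat \<Rightarrow>\<^sub>0 nat" where
  "pull_monomial a R m =
    (\<Sum>v\<in>keys m. single (fst v, the_inv_into R a (snd v)) (lookup m v))"

lemma lookup_pull_monomial:
  assumes a: "inj_on a R" and m: "snd ` keys m \<subseteq> a ` R"
  shows "lookup (pull_monomial a R m) (s, j) = (if j \<in> R then lookup m (s, a j) else 0)"
proof -
  have inv: "the_inv_into R a (snd v) \<in> R" "a (the_inv_into R a (snd v)) = snd v" if "v \<in> keys m" for v
    using m that the_inv_into_into[OF a, of "snd v" R] f_the_inv_into_f[OF a, of "snd v"] by auto
  have "lookup (pull_monomial a R m) (s, j) =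
      (\<Sum>v\<in>keys m. if (fst v, the_inv_into R a (snd v)) = (s, j) then lookup m v else 0)"
    by (simp add: pull_monomial_def lookup_sum lookup_single when_def)
  also have "\<dots> = (\<Sum>v\<in>keys m. if v = (s, a j) then (if j \<in> R then lookup m (s, a j) else 0) else 0)"
    using inv by (intro sum.cong) (auto simp: the_inv_into_f_f[OF a])
  also have "\<dots> = (if j \<in> R then lookup m (s, a j) else 0)"
    by (auto simp: in_keys_iff)
  finally show ?thesis .
qed

lemma pullback_monomial:
  assumes "finite R" and \<phi>: "(a, \<lambda>i\<in>R. 0) \<in> FI_hom (integer_mod_group d) R S"
  shows "pullback \<zeta> R (a, \<lambda>i\<in>R. 0) (single m 1) =
    (if snd ` keys m \<subseteq> a ` R then single (pull_monomial a R m) 1 else 0)"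
proof -
  let ?e = "pullback_var \<zeta> R (a, \<lambda>i\<in>R. 0)"
  have a: "inj_on a R" using \<phi> by (simp add: FI_hom_def)
  have eq: "pullback \<zeta> R (a, \<lambda>i\<in>R. 0) (single m 1) = subst_monom ?e m"
    by (simp add: pullback_eq poly_subst_single Const_one)
  show ?thesis
  proof (cases "snd ` keys m \<subseteq> a ` R")
    case True
    have "?e v = single (single (fst v, the_inv_into R a (snd v)) 1) 1" if v: "v \<in> keys m" for v
    proof -
      obtain j where j: "j \<in> R" "snd v = a j" using True v by blast
      have "(fst v, a j) = v" by (simp flip: j(2))
      moreover have "?e (fst v, a j) = Var (fst v) j"
        using pullback_var_eq[OF assms(1) \<phi> j(1), of \<zeta> "fst v"] j(1) by (simp add: Const_one)
      moreover have "the_inv_into R a (snd v) = j"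
        by (simp add: j(2) the_inv_into_f_f[OF a j(1)])
      ultimately show ?thesis by (simp add: Var_def)
    qed
    from subst_monom_monomials[OF this] True show ?thesis
      by (simp add: eq pull_monomial_def)
  next
    case False
    \<comment> \<open>The variable \<open>v\<close> is sent to zero.\<close>
    then obtain v where v: "v \<in> keys m" "snd v \<notin> a ` R" by blast
    then have "?e v ^ lookup m v = 0"
      using pullback_var_not_image[OF v(2), of \<zeta> _ "fst v"] by (simp add: in_keys_iff)
    then have "subst_monom ?e m = 0"
      unfolding subst_monom_def using v(1) by (intro prod_zero) auto
    with False show ?thesis by (simp add: eq)
  qed
qed

text \<open>
  Monomials are compared at the first pair \<open>(s, j)\<close>, in lexicographic order, at
  which their exponents differ.  The map \<open>(s, j) \<mapsto> (s, a j)\<close> is increasing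
  for this order of pairs, and the exponents outside its image vanish in both monomials.
\<close>

lemma pull_monomial_strict_mono:
  assumes a: "strict_mono_on R a"
    and m: "snd ` keys m \<subseteq> a ` R" and n: "snd ` keys n \<subseteq> a ` R" and "m < n"
  shows "pull_monomial a R m < pull_monomial a R n"
proof -
  note inj = strict_mono_on_imp_inj_on[OF a]
  obtain k where "lookup m k < lookup n k" "\<And>k'. k' < k \<Longrightarrow> lookup m k' = lookup n k'"
    using \<open>m < n\<close> unfolding less_poly_mapping.rep_eq less_fun_def by blast
  moreover obtain s i where "k = (s, i)" by (metis surj_pair)
  ultimately have k: "lookup m (s, i) < lookup n (s, i)" "\<And>k. k < (s, i) \<Longrightarrow> lookup m k = lookup n k"
    by simp_all
  then have "(s, i) \<in> keys n" by (auto simp: in_keys_iff)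
  then obtain j where j: "j \<in> R" "i = a j" using n by (auto simp: image_subset_iff)
  have "lookup (pull_monomial a R m) (s, j) < lookup (pull_monomial a R n) (s, j)"
    using k(1) j by (simp add: lookup_pull_monomial[OF inj m] lookup_pull_monomial[OF inj n])
  moreover have "lookup (pull_monomial a R m) k = lookup (pull_monomial a R n) k" if "k < (s, j)" for k
  proof -
    obtain s' j' where k': "k = (s', j')" by (metis surj_pair)
    have "(s', a j') < (s, a j)" if "j' \<in> R"
      using \<open>k < (s, j)\<close> strict_mono_onD[OF a that j(1)] by (auto simp: k')
    then show ?thesis
      using k(2)[of "(s', a j')"] j by (auto simp: k' lookup_pull_monomial[OF inj m] lookup_pull_monomial[OF inj n])
  qed
  ultimately show ?thesis
    unfolding less_poly_mapping.rep_eq less_fun_def by blast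
qed

text \<open>
  The translation between the combinatorics of words and morphisms: inserting zeros into the
  word of \<open>m\<close> amounts to moving \<open>m\<close> along an increasing injection.
\<close>

lemma order_embedding_of_pad:
  assumes "finite R" "finite S" and m: "m \<in> monomials r J R" and n: "n \<in> monomials r J S"
    and pad: "pad (\<lambda>_. 0) (columns R m) (columns S n)"
  obtains a where "a \<in> R \<rightarrow>\<^sub>E S" "strict_mono_on R a" "snd ` keys n \<subseteq> a ` R" "pull_monomial a R n = m"
proof -
  have set: "set (sorted_list_of_set R) = R" "set (sorted_list_of_set S) = S"
    using assms(1,2) by simp_all
  have "\<exists>a. a \<in> R \<rightarrow> S \<and> strict_mono_on R a \<and> (\<forall>x\<in>R. column n (a x) = column m x) \<and>
      (\<forall>y\<in>S - a ` R. column n y = (\<lambda>_. 0))"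
    using pad_imp_increasing_map[OF pad[unfolded columns_def]] by (simp add: set)
  then obtain a where a: "a \<in> R \<rightarrow> S" "strict_mono_on R a" "\<And>x. x \<in> R \<Longrightarrow> column n (a x) = column m x"
    "\<And>y. y \<in> S - a ` R \<Longrightarrow> column n y = (\<lambda>_. 0)"
    by blast
  let ?a = "restrict a R"
  have img: "?a ` R = a ` R" by auto
  have mono: "strict_mono_on R ?a" using a(2) by (simp add: strict_mono_on_def)
  have sub: "snd ` keys n \<subseteq> ?a ` R"
  proof
    fix i assume "i \<in> snd ` keys n"
    then obtain s where s: "(s, i) \<in> keys n" by auto
    then have "i \<in> S" using n by (auto simp: monomials_def)
    moreover have "column n i s \<noteq> 0" using s by (simp add: column_def in_keys_iff)
    ultimately show "i \<in> ?a ` R" unfolding img using a(4)[of i] by force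
  qed
  have "pull_monomial ?a R n = m"
  proof (rule poly_mapping_eqI)
    fix v :: "nat \<times> nat"
    obtain s j where v: "v = (s, j)" by (metis surj_pair)
    have "lookup m (s, j) = 0" if "j \<notin> R"
      using that m by (auto simp: monomials_def in_keys_iff)
    then show "lookup (pull_monomial ?a R n) v = lookup m v"
      using a(3)[of j] lookup_pull_monomial[OF strict_mono_on_imp_inj_on[OF mono] sub, of s j]
      by (auto simp: v column_def fun_eq_iff)
  qed
  with mono sub show thesis
    using a(1) by (intro that[of ?a]) auto
qed

section \<open>Linear functionals and lead monomials\<close>

abbreviation coinv_module ::
  "'k::field \<Rightarrow> nat \<Rightarrow> nat \<Rightarrow> (nat \<Rightarrow>\<^sub>0 nat) \<Rightarrow> nat set \<Rightarrow> ('k, 'k mpoly set) module" where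
  "coinv_module \<zeta> d r J S \<equiv> (coinv_alg \<zeta> d r S)\<lparr>carrier := coinv_piece \<zeta> d r S J\<rparr>"

abbreviation coinv_dual ::
  "'k::field \<Rightarrow> nat \<Rightarrow> nat \<Rightarrow> (nat \<Rightarrow>\<^sub>0 nat) \<Rightarrow> nat set \<Rightarrow> ('k, 'k mpoly set \<Rightarrow> 'k) module" where
  "coinv_dual \<zeta> d r J S \<equiv> dual_space ring_of_type_algebra (coinv_module \<zeta> d r J S)"

lemma coinv_class_piece:
  "p \<in> carrier (poly_alg r S) \<Longrightarrow> homogeneous J p \<Longrightarrow> coinv_class \<zeta> d r S p \<in> coinv_piece \<zeta> d r S J"
  by (auto simp: mem_coinv_piece)

lemma vectorspace_coinv_module:
  "vectorspace (ring_of_type_algebra :: 'k::field ring) (coinv_module (\<zeta> :: 'k) d r J S)"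
  by (rule vectorspace.subspace_is_vs[OF vectorspace_coinv_alg subspace_coinv_piece])

text \<open>
  Applied to the span of the classes of all monomials, this gives finite dimension; applied to
  the kernel of a functional, it shows that functionals are determined by their values on
  monomials.
\<close>

lemma coinv_class_in_submodule:
  assumes N: "submodule (ring_of_type_algebra :: 'k::field ring) N (coinv_module (\<zeta> :: 'k) d r J S)"
    and mono: "\<And>m. m \<in> M \<Longrightarrow> coinv_class \<zeta> d r S (single m 1) \<in> N"
    and M: "finite M" "M \<subseteq> monomials r J S"
  shows "coinv_class \<zeta> d r S (\<Sum>m\<in>M. single m (c m)) \<in> N"
  using M(1) M(2) mono
proof (induction M)
  case empty
  then show ?case using submodule.zero_closed[OF N] by (simp add: coinv_alg_simps)
next
  case (insert m M)
  have m: "m \<in> monomials r J S" and M: "M \<subseteq> monomials r J S" using insert.prems by auto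
  have sum: "(\<Sum>m\<in>M. single m (c m)) \<in> carrier (poly_alg r S)"
    using M by (intro poly_alg_sum) auto
  have "c m \<odot>\<^bsub>coinv_alg \<zeta> d r S\<^esub> coinv_class \<zeta> d r S (single m 1) \<in> N"
    using submodule.smult_closed[OF N, of "c m" "coinv_class \<zeta> d r S (single m 1)"] insert.prems by simp
  then have "coinv_class \<zeta> d r S (single m (c m)) \<in> N"
    using m by (simp add: coinv_alg_simps Const_mult_single)
  moreover have "coinv_class \<zeta> d r S (\<Sum>m\<in>M. single m (c m)) \<in> N"
    using insert.IH M insert.prems by simp
  ultimately have "coinv_class \<zeta> d r S (single m (c m)) \<oplus>\<^bsub>coinv_alg \<zeta> d r S\<^esub>
      coinv_class \<zeta> d r S (\<Sum>m\<in>M. single m (c m)) \<in> N"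
    using submodule.m_closed[OF N] by simp
  then show ?case
    using insert.hyps m sum by (simp add: coinv_alg_simps)
qed

lemma fin_dim_coinv_module:
  assumes "finite S"
  shows "vectorspace.fin_dim (ring_of_type_algebra :: 'k::field ring) (coinv_module (\<zeta> :: 'k) d r J S)"
proof -
  let ?K = "ring_of_type_algebra :: 'k ring" and ?V = "coinv_module \<zeta> d r J S"
  let ?span = "LinearCombinations.module.span ?K ?V"
  note V = vectorspace_coinv_module[where \<zeta> = \<zeta> and d = d and r = r and J = J and S = S]
  note M = vectorspace.axioms(1)[OF V]
  let ?B = "(\<lambda>m. coinv_class \<zeta> d r S (single m 1)) ` monomials r J S"
  have B: "?B \<subseteq> carrier (coinv_module \<zeta> d r J S)"
  proof (rule image_subsetI)
    fix m assume m: "m \<in> monomials r J S"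
    show "coinv_class \<zeta> d r S (single m 1) \<in> carrier ?V"
      using coinv_class_piece[OF single_monomial[OF m, of 1]] by simp
  qed
  have "carrier ?V \<subseteq> ?span ?B"
  proof
    fix x assume "x \<in> carrier ?V"
    then have "x \<in> coinv_piece \<zeta> d r S J" by simp
    then obtain p where p: "p \<in> carrier (poly_alg r S)" "homogeneous J p" "x = coinv_class \<zeta> d r S p"
      by (auto simp: mem_coinv_piece)
    note keys = keys_homogeneous_subset[OF p(1,2)]
    have "coinv_class \<zeta> d r S (\<Sum>m\<in>keys p. single m (lookup p m)) \<in> ?span ?B"
    proof (rule coinv_class_in_submodule[OF module.span_is_submodule[OF M B] _ finite_keys keys])
      fix m assume "m \<in> keys p"
      then show "coinv_class \<zeta> d r S (single m 1) \<in> ?span ?B"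
        by (intro subsetD[OF module.in_own_span[OF M B]] imageI subsetD[OF keys])
    qed
    then show "x \<in> ?span ?B" unfolding p(3) sum_single .
  qed
  moreover have "?span ?B \<subseteq> carrier (coinv_module \<zeta> d r J S)"
    using module.span_is_subset2[OF M B] .
  ultimately have "?span ?B = carrier ?V" by (rule subset_antisym[rotated])
  then show ?thesis
    unfolding vectorspace.fin_dim_def[OF V] 
    by (intro exI[of _ ?B] conjI finite_imageI finite_monomials assms B)
qed

lemma functional_zero:
  assumes f: "f \<in> carrier (coinv_dual \<zeta> d r J S)"
  shows "f (coinv_class \<zeta> d r S 0) = 0"
proof -
  have "coinv_class \<zeta> d r S 0 \<in> coinv_piece \<zeta> d r S J"
    by (rule coinv_class_piece) simp_all
  then have "f (0 \<odot>\<^bsub>coinv_alg \<zeta> d r S\<^esub> coinv_class \<zeta> d r S 0) = 0 * f (coinv_class \<zeta> d r S 0)"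
    using f unfolding mem_dual_space by simp
  then show ?thesis by (simp add: coinv_alg_simps)
qed

lemma functional_eq_zero:
  assumes f: "f \<in> carrier (coinv_dual (\<zeta> :: 'k::field) d r J S)"
    and zero: "\<And>m. m \<in> monomials r J S \<Longrightarrow> f (coinv_class \<zeta> d r S (single m 1)) = 0"
    and x: "x \<in> coinv_piece \<zeta> d r S J"
  shows "f x = 0"
proof -
  obtain p where p: "p \<in> carrier (poly_alg r S)" "homogeneous J p" "x = coinv_class \<zeta> d r S p"
    using x by (auto simp: mem_coinv_piece)
  have M: "module (ring_of_type_algebra :: 'k ring) (coinv_module \<zeta> d r J S)"
    by (rule vectorspace.axioms(1)[OF vectorspace_coinv_module])
  note closed = subspace.submod[OF subspace_coinv_piece[of \<zeta> d r S J]]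
  let ?N = "{x \<in> coinv_piece \<zeta> d r S J. f x = 0}"
  have N: "submodule (ring_of_type_algebra :: 'k ring) ?N (coinv_module \<zeta> d r J S)"
  proof (rule submodule.intro[OF M])
    show "\<zero>\<^bsub>coinv_module \<zeta> d r J S\<^esub> \<in> ?N"
      using functional_zero[OF f] submodule.zero_closed[OF closed] by (simp add: coinv_alg_simps)
    show "v \<oplus>\<^bsub>coinv_module \<zeta> d r J S\<^esub> w \<in> ?N" if "v \<in> ?N" "w \<in> ?N" for v w
      using that f submodule.m_closed[OF closed, of v w] by (simp add: mem_dual_space)
    show "c \<odot>\<^bsub>coinv_module \<zeta> d r J S\<^esub> v \<in> ?N" if "v \<in> ?N" for c v
      using that f submodule.smult_closed[OF closed, of c v] by (simp add: mem_dual_space)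
  qed auto
  have "coinv_class \<zeta> d r S (\<Sum>m\<in>keys p. single m (lookup p m)) \<in> ?N"
  proof (rule coinv_class_in_submodule[OF N _ finite_keys keys_homogeneous_subset[OF p(1,2)]])
    fix m assume "m \<in> keys p"
    then have "m \<in> monomials r J S" using keys_homogeneous_subset[OF p(1,2)] by blast
    then show "coinv_class \<zeta> d r S (single m 1) \<in> ?N"
      using zero by (simp add: coinv_class_piece)
  qed
  then show ?thesis unfolding p(3) sum_single by blast
qed

definition monomial_support ::
  "'k::field \<Rightarrow> nat \<Rightarrow> nat \<Rightarrow> (nat \<Rightarrow>\<^sub>0 nat) \<Rightarrow> nat set \<Rightarrow> ('k mpoly set \<Rightarrow> 'k) \<Rightarrow> (nat \<times> nat \<Rightarrow>\<^sub>0 nat) set" where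
  "monomial_support \<zeta> d r J S f = {m \<in> monomials r J S. f (coinv_class \<zeta> d r S (single m 1)) \<noteq> 0}"

text \<open>
  The maximum of an empty set is unspecified, so this is meaningful only for functionals with
  nonempty support.
\<close>

definition lead_monomial ::
  "'k::field \<Rightarrow> nat \<Rightarrow> nat \<Rightarrow> (nat \<Rightarrow>\<^sub>0 nat) \<Rightarrow> nat set \<Rightarrow> ('k mpoly set \<Rightarrow> 'k) \<Rightarrow> nat \<times> nat \<Rightarrow>\<^sub>0 nat" where
  "lead_monomial \<zeta> d r J S f = Max (monomial_support \<zeta> d r J S f)"

lemma finite_monomial_support: "finite S \<Longrightarrow> finite (monomial_support \<zeta> d r J S f)"
  using finite_monomials by (simp add: monomial_support_def)

lemma lead_monomial:
  assumes "finite S" "monomial_support \<zeta> d r J S f \<noteq> {}"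
  shows "lead_monomial \<zeta> d r J S f \<in> monomials r J S"
    "f (coinv_class \<zeta> d r S (single (lead_monomial \<zeta> d r J S f) 1)) \<noteq> 0"
    "m \<in> monomials r J S \<Longrightarrow> lead_monomial \<zeta> d r J S f < m \<Longrightarrow> f (coinv_class \<zeta> d r S (single m 1)) = 0"
proof -
  note fin = finite_monomial_support[OF assms(1), of \<zeta> d r J f]
  have "lead_monomial \<zeta> d r J S f \<in> monomial_support \<zeta> d r J S f"
    unfolding lead_monomial_def using fin assms(2) by (rule Max_in)
  then show "lead_monomial \<zeta> d r J S f \<in> monomials r J S"
    "f (coinv_class \<zeta> d r S (single (lead_monomial \<zeta> d r J S f) 1)) \<noteq> 0"
    by (simp_all add: monomial_support_def)
  assume m: "m \<in> monomials r J S" "lead_monomial \<zeta> d r J S f < m"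
  show "f (coinv_class \<zeta> d r S (single m 1)) = 0"
  proof (rule ccontr)
    assume "f (coinv_class \<zeta> d r S (single m 1)) \<noteq> 0"
    then have "m \<le> lead_monomial \<zeta> d r J S f"
      unfolding lead_monomial_def using m(1) by (intro Max_ge[OF fin]) (simp add: monomial_support_def)
    with m(2) show False by simp
  qed
qed

text \<open>
  The image \<open>h'\<close> of \<open>h\<close> takes at a monomial \<open>m\<close> the value
  of \<open>h\<close> at the pullback of \<open>m\<close>, which is zero or the monomial
  \<open>pull_monomial a R m\<close>.  Since the latter increases strictly with
  \<open>m\<close>, the lead monomial of \<open>h'\<close> is the monomial \<open>l\<close> over
  the lead monomial of \<open>h\<close>.
\<close>

lemma dual_map_lead_monomial:
  fixes \<zeta> :: "'k::field"
  assumes d: "d \<ge> 1" "\<zeta> ^ d = 1" and fin: "finite R" "finite S"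
    and a: "a \<in> R \<rightarrow>\<^sub>E S" "strict_mono_on R a"
    and h: "h \<in> carrier (coinv_dual \<zeta> d r J R)" "monomial_support \<zeta> d r J R h \<noteq> {}"
    and l: "l \<in> monomials r J S" "snd ` keys l \<subseteq> a ` R" "pull_monomial a R l = lead_monomial \<zeta> d r J R h"
  defines "\<phi> \<equiv> (a, \<lambda>i\<in>R. 0)"
  defines "h' \<equiv> dual_map (coinv_module \<zeta> d r J) (coinv_map \<zeta> d r) R S \<phi> h"
  shows "\<phi> \<in> FI_hom (integer_mod_group d) R S"
    "h' (coinv_class \<zeta> d r S (single l 1)) \<noteq> 0"
    "m \<in> monomials r J S \<Longrightarrow> l < m \<Longrightarrow> h' (coinv_class \<zeta> d r S (single m 1)) = 0"
proof -
  show \<phi>: "\<phi> \<in> FI_hom (integer_mod_group d) R S"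
    using a strict_mono_on_imp_inj_on[OF a(2)] by (auto simp: \<phi>_def FI_hom_def)
  note pull = pullback_monomial[OF fin(1) \<phi>[unfolded \<phi>_def], of \<zeta>, folded \<phi>_def]
  have h': "h' (coinv_class \<zeta> d r S (single m 1)) = h (coinv_class \<zeta> d r R (pullback \<zeta> R \<phi> (single m 1)))"
    if "m \<in> monomials r J S" for m
    using that coinv_class_piece[of "single m 1" r S J \<zeta> d]
    by (simp add: h'_def dual_map_def coinv_map_class[OF d fin \<phi>])
  show "h' (coinv_class \<zeta> d r S (single l 1)) \<noteq> 0"
    using lead_monomial(2)[OF fin(1) h(2)] by (simp add: h'[OF l(1)] pull l(2,3))
  assume m: "m \<in> monomials r J S" "l < m"
  show "h' (coinv_class \<zeta> d r S (single m 1)) = 0"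
  proof (cases "snd ` keys m \<subseteq> a ` R")
    case False
    then show ?thesis using functional_zero[OF h(1)] by (simp add: h'[OF m(1)] pull)
  next
    case True
    have "pullback \<zeta> R \<phi> (single m 1) \<in> carrier (poly_alg r R)" "homogeneous J (pullback \<zeta> R \<phi> (single m 1))"
      by (rule pullback_closed[OF single_monomial(1)[OF m(1)]],
          rule homogeneous_pullback[OF single_monomial(2)[OF m(1)]])
    then have "pull_monomial a R m \<in> monomials r J R"
      using True by (auto simp: pull poly_alg_iff homogeneous_iff monomials_def)
    moreover have "lead_monomial \<zeta> d r J R h < pull_monomial a R m"
      using pull_monomial_strict_mono[OF a(2) l(2) True m(2)] by (simp add: l(3))
    ultimately show ?thesis
      using True lead_monomial(3)[OF fin(1) h(2)] by (simp add: h'[OF m(1)] pull)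
  qed
qed

section \<open>Finite generation of the duals\<close>

text \<open>
  All lead words of functionals of multidegree \<open>J\<close> have letters in the finite set
  of columns with entries bounded by the total degree and supported on the support of
  \<open>J\<close>, and at most as many nonzero letters as the total degree.
\<close>

lemma leading_terms_finite_basis:
  fixes \<zeta> :: "'k::field"
  shows "\<exists>B. finite B \<and>
    B \<subseteq> {(S, f). finite S \<and> f \<in> carrier (coinv_dual \<zeta> d r J S) \<and> monomial_support \<zeta> d r J S f \<noteq> {}} \<and>
    (\<forall>S f. finite S \<longrightarrow> f \<in> carrier (coinv_dual \<zeta> d r J S) \<longrightarrow> monomial_support \<zeta> d r J S f \<noteq> {} \<longrightarrow>
      (\<exists>(R, h)\<in>B. pad (\<lambda>_. 0) (columns R (lead_monomial \<zeta> d r J R h)) (columns S (lead_monomial \<zeta> d r J S f))))"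
proof -
  let ?n = "\<Sum>s\<in>keys J. lookup J s"
  let ?C = "{c :: nat \<Rightarrow> nat. \<forall>s. (s \<in> keys J \<longrightarrow> c s \<in> {..?n}) \<and> (s \<notin> keys J \<longrightarrow> c s = 0)}"
  define U where
    "U = {(S, f). finite S \<and> f \<in> carrier (coinv_dual \<zeta> d r J S) \<and> monomial_support \<zeta> d r J S f \<noteq> {}}"
  define w where "w = (\<lambda>(S, f). columns S (lead_monomial \<zeta> d r J S f))"
  have C: "finite ?C"
    by (rule finite_set_of_finite_funs) simp_all
  have "\<exists>B. finite B \<and> B \<subseteq> U \<and> (\<forall>x\<in>U. \<exists>b\<in>B. pad (\<lambda>_. 0) (w b) (w x))"
  proof (rule pad_finite_basis[OF C])
    fix x assume "x \<in> U"
    then obtain S f where x: "x = (S, f)" "finite S" "monomial_support \<zeta> d r J S f \<noteq> {}"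
      by (auto simp: U_def)
    note l = lead_monomial(1)[OF x(2,3)]
    show "set (w x) \<subseteq> ?C"
      unfolding x(1) w_def prod.case by (rule columns_letters[OF l])
    show "length (filter (\<lambda>c. c \<noteq> (\<lambda>_. 0)) (w x)) \<le> ?n"
      unfolding x(1) w_def prod.case by (rule columns_nonzero[OF l x(2)])
  qed
  then obtain B where B: "finite B" "B \<subseteq> U" "\<forall>x\<in>U. \<exists>b\<in>B. pad (\<lambda>_. 0) (w b) (w x)"
    by (elim exE conjE)
  have "\<exists>(R, h)\<in>B. pad (\<lambda>_. 0) (columns R (lead_monomial \<zeta> d r J R h)) (columns S (lead_monomial \<zeta> d r J S f))"
    if "finite S" "f \<in> carrier (coinv_dual \<zeta> d r J S)" "monomial_support \<zeta> d r J S f \<noteq> {}" for S f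
  proof -
    have "(S, f) \<in> U" unfolding U_def using that by simp
    then obtain R h where "(R, h) \<in> B" "pad (\<lambda>_. 0) (w (R, h)) (w (S, f))"
      using B(3) by (metis surj_pair)
    then show ?thesis
      unfolding w_def prod.case by (intro bexI[of _ "(R, h)"]) simp_all
  qed
  then show ?thesis
    using B(1,2) unfolding U_def by (intro exI[of _ B] conjI allI impI)
qed

text \<open>
  Division with remainder: some member of \<open>B\<close> has an image with the same lead
  monomial as \<open>f\<close>, and subtracting a multiple of it cancels the lead term.  The
  induction is on the number of monomials that are at most the lead monomial.
\<close>

lemma functional_in_submodule:
  fixes \<zeta> :: "'k::field"
  assumes d: "d \<ge> 1" "\<zeta> ^ d = 1"
    and N: "FI_submodule (integer_mod_group d) (ring_of_type_algebra :: 'k ring) (coinv_dual \<zeta> d r J)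
      (dual_map (coinv_module \<zeta> d r J) (coinv_map \<zeta> d r)) N"
    and B: "\<And>R h. (R, h) \<in> B \<Longrightarrow> finite R" "\<And>R h. (R, h) \<in> B \<Longrightarrow> h \<in> carrier (coinv_dual \<zeta> d r J R)"
      "\<And>R h. (R, h) \<in> B \<Longrightarrow> monomial_support \<zeta> d r J R h \<noteq> {}" "\<And>R h. (R, h) \<in> B \<Longrightarrow> h \<in> N R"
    and basis: "\<And>S f. finite S \<Longrightarrow> f \<in> carrier (coinv_dual \<zeta> d r J S) \<Longrightarrow> monomial_support \<zeta> d r J S f \<noteq> {} \<Longrightarrow>
      \<exists>(R, h)\<in>B. pad (\<lambda>_. 0) (columns R (lead_monomial \<zeta> d r J R h)) (columns S (lead_monomial \<zeta> d r J S f))"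
    and S: "finite S" and f: "f \<in> carrier (coinv_dual \<zeta> d r J S)"
  shows "f \<in> N S"
proof -
  let ?K = "ring_of_type_algebra :: 'k ring"
  let ?c = "\<lambda>m. coinv_class \<zeta> d r S (single m 1)"
  have K: "ring ?K" by (rule ring_from_type_algebra)
  note simps = dual_space_simps[OF K]
  have sub: "submodule ?K (N S) (coinv_dual \<zeta> d r J S)"
    using N S unfolding FI_submodule_def by (intro subspace.submod) simp
  define below where "below = (\<lambda>f. {m \<in> monomials r J S. \<exists>n\<in>monomial_support \<zeta> d r J S f. m \<le> n})"
  have fin: "finite (below f)" for f
    using finite_monomials[OF S] by (simp add: below_def)
  show ?thesis
    using f
  proof (induction "card (below f)" arbitrary: f rule: less_induct)
    case less
    show ?case
    proof (cases "monomial_support \<zeta> d r J S f = {}")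
      case True
      have "f x = 0" if "x \<in> coinv_piece \<zeta> d r S J" for x
        using functional_eq_zero[OF less.prems _ that] True by (auto simp: monomial_support_def)
      moreover have "f \<in> extensional (coinv_piece \<zeta> d r S J)"
        using less.prems by (simp add: mem_dual_space PiE_def)
      ultimately have "f = (\<lambda>x\<in>coinv_piece \<zeta> d r S J. 0)"
        by (intro extensionalityI[of _ "coinv_piece \<zeta> d r S J"]) simp_all
      also have "\<dots> = \<zero>\<^bsub>coinv_dual \<zeta> d r J S\<^esub>"
        by (simp add: dual_space_def ring.func_space_def[OF K])
      finally show ?thesis
        using submodule.zero_closed[OF sub] by simp
    next
      case False
      let ?l = "lead_monomial \<zeta> d r J S f"
      note l = lead_monomial[OF S False]
      obtain R h where Rh: "(R, h) \<in> B" "pad (\<lambda>_. 0) (columns R (lead_monomial \<zeta> d r J R h)) (columns S ?l)"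
        using basis[OF S less.prems False] by (elim bexE) (simp split: prod.splits)
      note b = B[OF Rh(1)]
      obtain a where a: "a \<in> R \<rightarrow>\<^sub>E S" "strict_mono_on R a" "snd ` keys ?l \<subseteq> a ` R"
        "pull_monomial a R ?l = lead_monomial \<zeta> d r J R h"
        by (rule order_embedding_of_pad[OF b(1) S lead_monomial(1)[OF b(1,3)] l(1) Rh(2)])
      define \<phi> where "\<phi> = (a, \<lambda>i\<in>R. 0 :: int)"
      define h' where "h' = dual_map (coinv_module \<zeta> d r J) (coinv_map \<zeta> d r) R S \<phi> h"
      note lead = dual_map_lead_monomial[OF d b(1) S a(1,2) b(2,3) l(1) a(3,4), folded \<phi>_def, folded h'_def]
      have h'N: "h' \<in> N S"
        unfolding h'_def
        using N[unfolded FI_submodule_def, THEN conjunct2, rule_format, OF b(1) S lead(1)] b(4)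
        by (rule subsetD[OF _ imageI])
      have h': "h' \<in> carrier (coinv_dual \<zeta> d r J S)"
        using submodule.subset[OF sub] h'N by blast
      \<comment> \<open>The multiple of \<open>h'\<close> that cancels the lead term of \<open>f\<close>.\<close>
      define t where "t = f (?c ?l) / h' (?c ?l)"
      define f' where "f' = f \<oplus>\<^bsub>coinv_dual \<zeta> d r J S\<^esub> ((- t) \<odot>\<^bsub>coinv_dual \<zeta> d r J S\<^esub> h')"
      interpret D: vectorspace ?K "coinv_dual \<zeta> d r J S"
        by (rule vectorspace_dual_space[OF vectorspace_coinv_module])
      have f'_dual: "f' \<in> carrier (coinv_dual \<zeta> d r J S)"
        unfolding f'_def by (intro D.M.a_closed less.prems D.smult_closed h') (simp only: ring_of_type_simps UNIV_I)
      have f'_val: "f' x = f x - t * h' x" if "x \<in> coinv_piece \<zeta> d r S J" for x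
        using that by (simp add: f'_def simps)
      have f'_mono: "f' (?c m) = f (?c m) - t * h' (?c m)" if "m \<in> monomials r J S" for m
        using that by (intro f'_val coinv_class_piece[OF single_monomial])
      have f'_l: "f' (?c ?l) = 0"
        using lead(2) by (simp add: f'_mono[OF l(1)] t_def)
      have f'_high: "f' (?c m) = 0" if "m \<in> monomials r J S" "?l < m" for m
        using l(3)[OF that] lead(3)[OF that] by (simp add: f'_mono[OF that(1)])
      have supp': "n < ?l" if "n \<in> monomial_support \<zeta> d r J S f'" for n
        using that f'_l f'_high[of n] by (auto simp: monomial_support_def intro: linorder_cases[of n ?l])
      have l_supp: "?l \<in> monomial_support \<zeta> d r J S f"
        using l(1,2) by (simp add: monomial_support_def)
      have "below f' \<subseteq> below f - {?l}"
      proof (intro subsetI)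
        fix m assume "m \<in> below f'"
        then obtain n where m: "m \<in> monomials r J S" and n: "n \<in> monomial_support \<zeta> d r J S f'" "m \<le> n"
          unfolding below_def by blast
        have "m < ?l"
          using n(2) supp'[OF n(1)] by (rule le_less_trans)
        then show "m \<in> below f - {?l}"
          using m l_supp unfolding below_def by (auto intro: less_imp_le)
      qed
      moreover have "?l \<in> below f"
        using l(1) l_supp by (auto simp: below_def)
      ultimately have "card (below f') < card (below f)"
        by (intro psubset_card_mono[OF fin]) blast
      then have "f' \<in> N S"
        using f'_dual by (rule less.hyps)
      moreover have "t \<odot>\<^bsub>coinv_dual \<zeta> d r J S\<^esub> h' \<in> N S"
        using submodule.smult_closed[OF sub _ h'N] by simp
      ultimately have "f' \<oplus>\<^bsub>coinv_dual \<zeta> d r J S\<^esub> (t \<odot>\<^bsub>coinv_dual \<zeta> d r J S\<^esub> h') \<in> N S"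
        by (rule submodule.m_closed[OF sub])
      moreover have "f' \<oplus>\<^bsub>coinv_dual \<zeta> d r J S\<^esub> (t \<odot>\<^bsub>coinv_dual \<zeta> d r J S\<^esub> h') = f"
      proof (rule extensionalityI[of _ "coinv_piece \<zeta> d r S J"])
        show "f' \<oplus>\<^bsub>coinv_dual \<zeta> d r J S\<^esub> (t \<odot>\<^bsub>coinv_dual \<zeta> d r J S\<^esub> h') \<in> extensional (coinv_piece \<zeta> d r S J)"
          by (simp add: simps)
        show "f \<in> extensional (coinv_piece \<zeta> d r S J)"
          using less.prems by (simp add: mem_dual_space PiE_def)
      qed (simp add: simps f'_val)
      ultimately show ?thesis by simp
    qed
  qed
qed

lemma fin_gen_coinv_dual:
  fixes \<zeta> :: "'k::field"
  assumes d: "d \<ge> 1" "\<zeta> ^ d = 1"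
  shows "\<exists>B. finite B \<and> (\<forall>(S, v)\<in>B. finite S \<and> v \<in> carrier (coinv_dual \<zeta> d r J S)) \<and>
    (\<forall>N. FI_submodule (integer_mod_group d) (ring_of_type_algebra :: 'k ring) (coinv_dual \<zeta> d r J)
        (dual_map (coinv_module \<zeta> d r J) (coinv_map \<zeta> d r)) N \<longrightarrow>
      (\<forall>(S, v)\<in>B. v \<in> N S) \<longrightarrow> (\<forall>S. finite S \<longrightarrow> N S = carrier (coinv_dual \<zeta> d r J S)))"
proof -
  obtain B where B: "finite B"
    "B \<subseteq> {(S, f). finite S \<and> f \<in> carrier (coinv_dual \<zeta> d r J S) \<and> monomial_support \<zeta> d r J S f \<noteq> {}}"
    "\<forall>S f. finite S \<longrightarrow> f \<in> carrier (coinv_dual \<zeta> d r J S) \<longrightarrow> monomial_support \<zeta> d r J S f \<noteq> {} \<longrightarrow>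
      (\<exists>(R, h)\<in>B. pad (\<lambda>_. 0) (columns R (lead_monomial \<zeta> d r J R h)) (columns S (lead_monomial \<zeta> d r J S f)))"
    using leading_terms_finite_basis[where \<zeta> = \<zeta> and d = d and r = r and J = J] by (elim exE conjE)
  note basis = B(3)[rule_format]
  have B': "finite R" "h \<in> carrier (coinv_dual \<zeta> d r J R)" "monomial_support \<zeta> d r J R h \<noteq> {}"
    if "(R, h) \<in> B" for R h
    using subsetD[OF B(2) that] by simp_all
  have "N S = carrier (coinv_dual \<zeta> d r J S)"
    if N: "FI_submodule (integer_mod_group d) (ring_of_type_algebra :: 'k ring) (coinv_dual \<zeta> d r J)
        (dual_map (coinv_module \<zeta> d r J) (coinv_map \<zeta> d r)) N"
      and BN: "\<forall>(S, v)\<in>B. v \<in> N S" and S: "finite S" for N S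
  proof (rule subset_antisym)
    show "N S \<subseteq> carrier (coinv_dual \<zeta> d r J S)"
    proof (rule submodule.subset[OF subspace.submod])
      show "VectorSpace.subspace (ring_of_type_algebra :: 'k ring) (N S) (coinv_dual \<zeta> d r J S)"
        using N S unfolding FI_submodule_def by simp
    qed
    show "carrier (coinv_dual \<zeta> d r J S) \<subseteq> N S"
    proof
      fix f assume "f \<in> carrier (coinv_dual \<zeta> d r J S)"
      then show "f \<in> N S"
        using BN by (intro functional_in_submodule[OF d N B' _ basis S]) auto
    qed
  qed
  then show ?thesis
    using B(1) B' by (intro exI[of _ B]) auto
qed

theorem theorem4p2:
  fixes \<zeta> :: "'k::field" and d r :: nat
  assumes "d \<ge> 1" and "r \<ge> 1" and "primitive_root d \<zeta>"
  shows "finite_type_graded_co_FI_algebra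
    (integer_mod_group d) (ring_of_type_algebra :: 'k ring) (multidegrees r)
    (coinv_alg \<zeta> d r) (coinv_piece \<zeta> d r) (coinv_map \<zeta> d r)"
proof -
  have \<zeta>: "\<zeta> ^ d = 1"
    using assms(3) by (rule primitive_root_power)
  interpret C: graded_co_FI_algebra "integer_mod_group d" "ring_of_type_algebra :: 'k ring" "multidegrees r"
    "coinv_alg \<zeta> d r" "coinv_piece \<zeta> d r" "coinv_map \<zeta> d r"
    by (rule graded_co_FI_algebra_coinv[OF assms(1) \<zeta>])
  have piece: "C.piece J = coinv_module \<zeta> d r J" for J
    by (rule ext) (simp add: C.piece_def)
  show ?thesis
  proof (rule finite_type_graded_co_FI_algebra.intro[OF C.graded_co_FI_algebra_axioms],
      rule finite_type_graded_co_FI_algebra_axioms.intro)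
    show "vectorspace.fin_dim (ring_of_type_algebra :: 'k ring) (C.piece J S)" if "finite S" for J S
      unfolding piece by (rule fin_dim_coinv_module[OF that])
    show "fin_gen_FI_module (integer_mod_group d) (ring_of_type_algebra :: 'k ring)
        (\<lambda>S. dual_space ring_of_type_algebra (C.piece J S)) (dual_map (C.piece J) (coinv_map \<zeta> d r))"
      if "J \<in> multidegrees r" for J
      using C.FI_module_dual[OF that] fin_gen_coinv_dual[OF assms(1) \<zeta>, of r J]
      unfolding piece by (intro fin_gen_FI_module.intro fin_gen_FI_module_axioms.intro)
  qed
qed

end
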